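(* If $n$ is a positive integer divisible by $16$, then $\mathrm{ex}^*(n, C_5, P_5) = 12n$.
   Context: An edge-coloring is proper if any two edges sharing a vertex receive different colors. An edge-colored subgraph is rainbow if no two of its edges have the same color. $P_5$ denotes the path with $5$ edges and $C_5$ the cycle of length $5$. $\mathrm{ex}^*(n,H,F)$ is the maximum number of rainbow copies of $H$ (as subgraphs) in an $n$-vertex simple graph with a proper edge-coloring containing no rainbow copy of $F$. *)

theory Defs
  imports Main
begin

text \<open>A graph is a pair of a vertex set and a set of edges, each edge being a two-element
  set of vertices.\<close>

type_synonym 'a ugraph = "'a set \<times> 'a set set"

abbreviation verts :: "'a ugraph \<Rightarrow> 'a set" where
  "verts G \<equiv> fst G"

abbreviation edges :: "'a ugraph \<Rightarrow> 'a set set" where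
  "edges G \<equiv> snd G"

definition simple_graph :: "'a ugraph \<Rightarrow> bool" where
  "simple_graph G \<longleftrightarrow> finite (verts G) \<and> (\<forall>e\<in>edges G. e \<subseteq> verts G \<and> card e = 2)"

definition subgraph :: "'a ugraph \<Rightarrow> 'a ugraph \<Rightarrow> bool" where
  "subgraph K G \<longleftrightarrow> simple_graph K \<and> verts K \<subseteq> verts G \<and> edges K \<subseteq> edges G"

definition graph_iso :: "'a ugraph \<Rightarrow> 'b ugraph \<Rightarrow> bool" where
  "graph_iso H K \<longleftrightarrow>
    (\<exists>f. bij_betw f (verts H) (verts K) \<and> edges K = (\<lambda>e. f ` e) ` edges H)"

definition path_graph :: "nat \<Rightarrow> nat ugraph" where
  "path_graph k = ({0..k}, {{i, i + 1} | i. i < k})"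

text \<open>Meaningful for \<open>k \<ge> 3\<close> only.\<close>

definition cycle_graph :: "nat \<Rightarrow> nat ugraph" where
  "cycle_graph k = ({0..<k}, {{i, (i + 1) mod k} | i. i < k})"

definition proper_edge_coloring :: "'a ugraph \<Rightarrow> ('a set \<Rightarrow> 'c) \<Rightarrow> bool" where
  "proper_edge_coloring G c \<longleftrightarrow>
    (\<forall>e\<in>edges G. \<forall>f\<in>edges G. e \<noteq> f \<and> e \<inter> f \<noteq> {} \<longrightarrow> c e \<noteq> c f)"

definition rainbow :: "('a set \<Rightarrow> 'c) \<Rightarrow> 'a ugraph \<Rightarrow> bool" where
  "rainbow c K \<longleftrightarrow> inj_on c (edges K)"

definition rainbow_copies ::
  "'b ugraph \<Rightarrow> 'a ugraph \<Rightarrow> ('a set \<Rightarrow> 'c) \<Rightarrow> 'a ugraph set" where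
  "rainbow_copies H G c = {K. subgraph K G \<and> graph_iso H K \<and> rainbow c K}"

text \<open>Vertices and colors are drawn from \<^typ>\<open>nat\<close>. This loses no generality, since the
  graphs are finite and only equality of vertices and of colors matters. The number of
  colors is not bounded.\<close>

definition rainbow_copy_counts :: "nat \<Rightarrow> 'b ugraph \<Rightarrow> 'd ugraph \<Rightarrow> nat set" where
  "rainbow_copy_counts n H F =
    {card (rainbow_copies H G c) | (G :: nat ugraph) (c :: nat set \<Rightarrow> nat).
       simple_graph G \<and> card (verts G) = n \<and> proper_edge_coloring G c \<and>
       rainbow_copies F G c = {}}"

definition ex_star :: "nat \<Rightarrow> 'b ugraph \<Rightarrow> 'd ugraph \<Rightarrow> nat" where
  "ex_star n H F = Max (rainbow_copy_counts n H F)"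

text \<open>The maximum is taken over a finite set, which is nonempty as soon as the forbidden
  graph has an edge.\<close>

lemma rainbow_copies_subset:
  assumes "simple_graph G"
  shows "rainbow_copies H G c \<subseteq> Pow (verts G) \<times> Pow (Pow (verts G))"
  using assms unfolding rainbow_copies_def subgraph_def simple_graph_def by fastforce

lemma finite_rainbow_copies:
  assumes "simple_graph G"
  shows "finite (rainbow_copies H G c)"
  by (rule finite_subset[OF rainbow_copies_subset[OF assms]])
     (use assms in \<open>simp add: simple_graph_def\<close>)

lemma finite_rainbow_copy_counts: "finite (rainbow_copy_counts n H F)"
proof (rule finite_subset)
  show "rainbow_copy_counts n H F \<subseteq> {..2 ^ n * 2 ^ 2 ^ n}"
  proof
    fix m assume "m \<in> rainbow_copy_counts n H F"
    then obtain G :: "nat ugraph" and c :: "nat set \<Rightarrow> nat" where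
      m: "m = card (rainbow_copies H G c)" and G: "simple_graph G" "card (verts G) = n"
      unfolding rainbow_copy_counts_def by blast
    have fin: "finite (verts G)" using G(1) by (simp add: simple_graph_def)
    have "m \<le> card (Pow (verts G) \<times> Pow (Pow (verts G)))"
      unfolding m using fin by (intro card_mono[OF _ rainbow_copies_subset[OF G(1)]]) simp
    then show "m \<in> {..2 ^ n * 2 ^ 2 ^ n}"
      using fin G(2) by (simp add: card_cartesian_product card_Pow)
  qed
qed simp

lemma rainbow_copy_counts_nonempty:
  assumes "edges F \<noteq> {}"
  shows "rainbow_copy_counts n H F \<noteq> {}"
proof -
  let ?G = "({..<n}, {}) :: nat ugraph"
  have "rainbow_copies F ?G (\<lambda>_. 0 :: nat) = {}"
    using assms by (auto simp: rainbow_copies_def subgraph_def graph_iso_def)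
  then have "card (rainbow_copies H ?G (\<lambda>_. 0 :: nat)) \<in> rainbow_copy_counts n H F"
    unfolding rainbow_copy_counts_def
    by (intro CollectI exI[of _ ?G] exI[of _ "\<lambda>_. 0"])
       (simp add: simple_graph_def proper_edge_coloring_def)
  then show ?thesis by blast
qed

lemma simple_graph_path_graph: "simple_graph (path_graph k)"
  by (auto simp: simple_graph_def path_graph_def)

lemma simple_graph_cycle_graph:
  assumes "3 \<le> k"
  shows "simple_graph (cycle_graph k)"
proof -
  have "i \<noteq> Suc i mod k" if "i < k" for i
    using that assms by (cases "Suc i = k") auto
  then show ?thesis
    using assms by (auto simp: simple_graph_def cycle_graph_def card_2_iff)
qed

end

theory Submission
  imports Defs
begin

text \<open>Every vertex \<open>v\<close> lies on at most 60 rainbow 5-cycles; double counting then gives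
  \<open>5 N \<le> 60 n\<close>. Starting from \<open>v\<close>, a properly coloured walk is determined by its colour word, so if
  all rainbow 5-cycles at \<open>v\<close> use the same five colours there are at most \<open>5! / 2\<close> of them; if they
  all have the same vertex set there are at most \<open>4! / 2\<close>. Both ``same colours'' and ``same vertices''
  are equivalence relations, so otherwise some \<open>C\<close> and \<open>D\<close> differ in both respects, and every
  cycle at \<open>v\<close> shares its vertex set with \<open>C\<close> or \<open>D\<close> (at most \<open>12 + 12\<close>) or differs in both respects
  from \<open>C\<close> or from \<open>D\<close>. An exhaustive search, pruned by the absence of a rainbow path with five edges,
  shows that at most 17 cycles at \<open>v\<close> differ in both respects from a given one, and
  \<open>12 + 12 + 17 + 17 < 60\<close>.

  Equality holds for disjoint copies of the 5-regular Cayley graph of \<open>(\<int>/2)\<^sup>4\<close> with generators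
  \<open>1, 2, 4, 8, 15\<close>, coloured by generators: the sum of the five generators is 0, so every walk using
  each colour once is a closed 5-cycle.\<close>

section \<open>Rainbow paths and cycles\<close>

fun cols :: "('a set \<Rightarrow> 'c) \<Rightarrow> 'a list \<Rightarrow> 'c list" where
  "cols c (u # v # p) = c {u, v} # cols c (v # p)"
| "cols c _ = []"

lemma cols_append:
  "p \<noteq> [] \<Longrightarrow> q \<noteq> [] \<Longrightarrow> cols c (p @ q) = cols c p @ c {last p, hd q} # cols c q"
  by (induction c p rule: cols.induct) (auto simp: neq_Nil_conv)

lemma cols_rev: "cols c (rev p) = rev (cols c p)"
proof (induction c p rule: cols.induct)
  case (1 c u v p)
  have "cols c (rev (u # v # p)) = cols c (rev (v # p) @ [u])" by simp
  also have "\<dots> = cols c (rev (v # p)) @ [c {v, u}]"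
    by (subst cols_append) (auto simp: last_rev)
  finally show ?case using 1 by (simp add: insert_commute)
qed auto

definition rainbow_path :: "'a ugraph \<Rightarrow> ('a set \<Rightarrow> 'c) \<Rightarrow> 'a list \<Rightarrow> bool" where
  "rainbow_path G c p \<longleftrightarrow> distinct p \<and> successively (\<lambda>u v. {u, v} \<in> edges G) p \<and> distinct (cols c p)"

text \<open>A cycle is a list of its five vertices, so one subgraph \<open>cyc p\<close> comes from
  ten lists: five starting vertices and two directions.\<close>

definition rainbow_cycle :: "'a ugraph \<Rightarrow> ('a set \<Rightarrow> 'c) \<Rightarrow> 'a list \<Rightarrow> bool" where
  "rainbow_cycle G c p \<longleftrightarrow> length p = 5 \<and> distinct p \<and>
     successively (\<lambda>u v. {u, v} \<in> edges G) (p @ [hd p]) \<and> distinct (cols c (p @ [hd p]))"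

lemma rainbow_path_rev: "rainbow_path G c (rev p) \<longleftrightarrow> rainbow_path G c p"
  by (simp add: rainbow_path_def cols_rev insert_commute)

lemma length_eq_5: "length p = 5 \<longleftrightarrow> (\<exists>a b d e f. p = [a,b,d,e,f])"
  by (auto simp: length_Suc_conv eval_nat_numeral)

lemma length_eq_6: "length p = 6 \<longleftrightarrow> (\<exists>a b d e f g. p = [a,b,d,e,f,g])"
  by (auto simp: length_Suc_conv eval_nat_numeral)

lemma lessThan_5: "{..<5} = {0, 1, 2, 3, 4::nat}"
  by auto

lemma edges_path_graph_5: "edges (path_graph 5) = {{0,1},{1,2},{2,3},{3,4},{4,5}}"
proof -
  have "edges (path_graph 5) = (\<lambda>i. {i, i + 1}) ` {..<5}"
    unfolding path_graph_def snd_conv image_def by (simp add: Bex_def conj_commute)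
  then show ?thesis unfolding lessThan_5 by (simp add: numeral_eq_Suc)
qed

lemma edges_cycle_graph_5: "edges (cycle_graph 5) = {{0,1},{1,2},{2,3},{3,4},{4,0}}"
proof -
  have "edges (cycle_graph 5) = (\<lambda>i. {i, (i + 1) mod 5}) ` {..<5}"
    unfolding cycle_graph_def snd_conv image_def by (simp add: Bex_def conj_commute)
  then show ?thesis unfolding lessThan_5 by (simp add: numeral_2_eq_2)
qed

lemma verts_path_graph_5: "verts (path_graph 5) = {0,1,2,3,4,5}"
  unfolding path_graph_def by auto

lemma verts_cycle_graph_5: "verts (cycle_graph 5) = {0,1,2,3,4}"
  unfolding cycle_graph_def by auto

text \<open>The isomorphism is the position function \<open>(!) p\<close>. This turns
  \<open>P5_free\<close> into a fact about lists: no rainbow path has six vertices.\<close>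

lemma rainbow_path_copy:
  assumes "rainbow_path G c p" "length p = 6" "simple_graph G"
  shows "rainbow_copies (path_graph 5) G c \<noteq> {}"
proof -
  obtain x0 x1 x2 x3 x4 x5 where p: "p = [x0,x1,x2,x3,x4,x5]" using assms(2) length_eq_6 by metis
  let ?K = "(set p, {{x0,x1},{x1,x2},{x2,x3},{x3,x4},{x4,x5}})"
  have d: "distinct [x0,x1,x2,x3,x4,x5]" using assms(1) p by (simp add: rainbow_path_def)
  have E: "edges ?K \<subseteq> edges G" using assms(1) by (auto simp: p rainbow_path_def)
  have V: "set p \<subseteq> verts G" using assms(3) E unfolding simple_graph_def p by fastforce
  have "graph_iso (path_graph 5) ?K"
    unfolding graph_iso_def
  proof (intro exI conjI)
    show "bij_betw ((!) p) (verts (path_graph 5)) (verts ?K)"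
      unfolding bij_betw_def verts_path_graph_5 using d by (auto simp: p)
    show "edges ?K = (\<lambda>e. (!) p ` e) ` edges (path_graph 5)"
      unfolding edges_path_graph_5 by (simp add: p)
  qed
  moreover have "subgraph ?K G"
    using E V d unfolding subgraph_def simple_graph_def p by auto
  moreover have "rainbow c ?K"
    using assms(1) unfolding rainbow_def rainbow_path_def p by (auto simp: inj_on_def)
  ultimately show ?thesis unfolding rainbow_copies_def by blast
qed

definition cycle_cols :: "('a set \<Rightarrow> 'c) \<Rightarrow> 'a list \<Rightarrow> 'c list" where
  "cycle_cols c p = cols c (p @ [hd p])"

definition cyc :: "'a list \<Rightarrow> 'a ugraph" where
  "cyc p = (set p, (\<lambda>(u, v). {u, v}) ` set (zip p (tl p @ [hd p])))"

lemma cyc_5: "cyc [x,y,z,t,w] = ({x,y,z,t,w}, {{x,y},{y,z},{z,t},{t,w},{w,x}})"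
  by (simp add: cyc_def)

lemma cycle_cols_5: "cycle_cols c [x,y,z,t,w] = [c {x,y},c {y,z},c {z,t},c {t,w},c {w,x}]"
  by (simp add: cycle_cols_def)

lemma rainbow_cycle_5:
  "rainbow_cycle G c [x,y,z,t,w] \<longleftrightarrow> distinct [x,y,z,t,w] \<and>
     {{x,y},{y,z},{z,t},{t,w},{w,x}} \<subseteq> edges G \<and> distinct [c {x,y},c {y,z},c {z,t},c {t,w},c {w,x}]"
  by (auto simp: rainbow_cycle_def)

lemma rainbow_cycleE:
  assumes "rainbow_cycle G c p"
  obtains x y z t w where "p = [x,y,z,t,w]"
  using assms length_eq_5 unfolding rainbow_cycle_def by metis

text \<open>The same cycle from the same start in the other direction; the two directions are the
  factor 2 in all counts at a fixed vertex.\<close>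

definition reflect :: "'a list \<Rightarrow> 'a list" where
  "reflect p = hd p # rev (tl p)"

lemma reflect:
  assumes "rainbow_cycle G c p"
  shows "rainbow_cycle G c (reflect p)" "cyc (reflect p) = cyc p" "hd (reflect p) = hd p"
    "reflect p \<noteq> p" "cycle_cols c (reflect p) = rev (cycle_cols c p)"
proof -
  obtain x y z t w where p: "p = [x,y,z,t,w]" using rainbow_cycleE[OF assms] .
  show "rainbow_cycle G c (reflect p)" 
    using assms unfolding p reflect_def by (simp add: rainbow_cycle_5 insert_commute) metis
  show "cyc (reflect p) = cyc p" unfolding p reflect_def by (simp add: cyc_5) (simp add: insert_commute)
  show "reflect p \<noteq> p" using assms unfolding p by (simp add: reflect_def rainbow_cycle_5)
  show "cycle_cols c (reflect p) = rev (cycle_cols c p)"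
    unfolding p by (simp add: reflect_def cycle_cols_5 insert_commute)
qed (simp add: reflect_def)

locale rainbow_P5_free =
  fixes G :: "'a ugraph" and c :: "'a set \<Rightarrow> 'c"
  assumes simple: "simple_graph G"
    and proper: "proper_edge_coloring G c"
    and P5_free: "rainbow_copies (path_graph 5) G c = {}"

section \<open>The search for 5-cycles through a vertex of a given one\<close>

text \<open>Names in the search: the vertices of the given cycle are \<open>0, \<dots>, 4\<close> in cyclic order, its edge
  \<open>{i, i + 1}\<close> has colour \<open>i\<close>, and further vertices and colours are numbered from 5 on as they appear.
  Entry \<open>a\<close> of a state lists the pairs (neighbour of \<open>a\<close>, colour of the edge) known so far.\<close>

type_synonym adjs = "(nat \<times> nat) list list"
type_synonym code = "nat list \<times> nat list"

text \<open>Two disjoint paths ending in \<open>a\<close> and \<open>b\<close>, with four edges in total, become a path with five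
  edges once the edge \<open>{a, b}\<close> is added; if the two are jointly rainbow, that edge must therefore repeat
  one of their colours. Both paths are grown from \<open>[a, b]\<close>, first at one end along the neighbours \<open>N\<close>,
  then at the other end along \<open>M\<close>, with visited vertices \<open>vs\<close>, used colours \<open>ds\<close> and \<open>k\<close> edges
  still to go; \<open>al\<close> holds the colours of \<open>{a, b}\<close> not yet excluded.\<close>

function allowed :: "adjs \<Rightarrow> nat \<Rightarrow> (nat \<times> nat) list \<Rightarrow> (nat \<times> nat) list \<Rightarrow> nat list \<Rightarrow> nat list \<Rightarrow>
    nat list \<Rightarrow> nat list" where
  "allowed s 0 N M vs ds al = filter (\<lambda>d. List.member ds d) al"
| "allowed s (Suc k) [] [] vs ds al = al"
| "allowed s (Suc k) [] (e # M) vs ds al = allowed s (Suc k) (e # M) [] vs ds al"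
| "allowed s (Suc k) ((u, d) # N) M vs ds al =
    (if List.member ds d then allowed s (Suc k) N M vs ds al
     else if List.member vs u then allowed s (Suc k) N M vs ds al
     else case allowed s k (s ! u) M (u # vs) (d # ds) al of [] \<Rightarrow> []
          | a # al' \<Rightarrow> allowed s (Suc k) N M vs ds (a # al'))"
  by pat_completeness auto
termination
  \<comment> \<open>Handing \<open>M\<close> over to the first slot lengthens \<open>N\<close>, so
    \<open>length M\<close> is compared before \<open>length N\<close>.\<close>
  by (relation "measures [\<lambda>(s, k, N, M, _). k, \<lambda>(s, k, N, M, _). length M, \<lambda>(s, k, N, M, _). length N]") auto

text \<open>\<open>m\<close> is the name for a colour not seen before, hence the range up to
  \<open>Suc m\<close>. Colours in \<open>ds\<close> would spoil the rainbow cycle, those present at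
  \<open>a\<close> or \<open>b\<close> would violate properness. The 4 counts the edges of a
  five-edge path other than \<open>{a, b}\<close>.\<close>

definition extensions :: "adjs \<Rightarrow> nat \<Rightarrow> nat \<Rightarrow> nat \<Rightarrow> nat list \<Rightarrow> (nat \<times> adjs) list" where
  "extensions s m a b ds = (case map_of (s ! a) b of
     Some d \<Rightarrow> if List.member ds d then [] else [(d, s)]
   | None \<Rightarrow> map (\<lambda>d. (d, s[a := (b, d) # s ! a, b := (a, d) # s ! b]))
       (allowed s 4 (s ! a) (s ! b) [a, b] [] (filter (\<lambda>d. \<not> List.member (ds @ map snd (s ! a) @ map snd (s ! b)) d) [0..<Suc m])))"

text \<open>A code lists the vertices and the edge colours of a 5-cycle through vertex 0, with the label 5 for
  any vertex and any colour that is not on the given cycle. Up to reversal, the codes below are those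
  that the search finds for cycles using both a new vertex and a new colour. They are grouped so that two
  cycles with different codes from one class cannot coexist.\<close>

definition code_classes :: "code list list" where
  "code_classes = [
    [([0,1,3,5,2],[0,5,1,4,3]),
       ([0,2,1,4,5],[5,1,2,0,3]),
       ([0,2,4,3,5],[5,0,3,4,1]),
       ([0,2,4,5,3],[5,0,2,4,1]),
       ([0,2,5,1,3],[3,0,2,4,5]),
       ([0,3,1,2,5],[5,4,1,0,3]),
       ([0,3,1,5,4],[1,5,2,0,4]),
       ([0,5,5,5,5],[1,4,5,0,3])],
      [([0,1,3,4,5],[0,5,3,2,1]),
       ([0,1,4,5,3],[0,5,2,4,1]),
       ([0,2,3,4,5],[5,2,3,0,1]),
       ([0,3,1,4,5],[1,5,2,0,3]),
       ([0,4,1,3,5],[4,2,5,0,1]),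
       ([0,5,2,4,5],[1,0,5,2,3])],
      [([0,1,5,2,4],[0,2,3,5,4]),
       ([0,1,5,4,2],[0,2,1,5,3]),
       ([0,2,4,1,5],[3,5,2,4,1]),
       ([0,2,5,1,4],[5,0,3,2,4]),
       ([0,2,5,4,5],[5,3,2,0,1]),
       ([0,4,1,2,5],[4,5,1,3,2])],
      [([0,1,3,2,5],[0,5,2,4,3]),
       ([0,2,3,1,5],[3,2,5,4,1]),
       ([0,3,1,2,5],[5,4,1,3,2]),
       ([0,3,2,1,5],[5,2,1,4,3]),
       ([0,5,3,5,5],[3,4,0,5,2])],
      [([0,1,2,4,5],[0,1,5,2,3]),
       ([0,1,4,2,5],[0,2,5,3,1]),
       ([0,1,4,5,2],[0,5,2,3,5]),
       ([0,2,1,5,3],[3,1,2,4,5]),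
       ([0,2,1,5,4],[5,1,3,2,4])],
      [([0,1,5,2,3],[0,4,3,2,5]),
       ([0,1,5,4,2],[0,4,2,5,3]),
       ([0,2,3,1,5],[5,2,4,3,1]),
       ([0,2,5,4,3],[5,0,2,3,1]),
       ([0,3,5,2,5],[5,4,3,0,1])],
      [([0,1,4,5,3],[0,2,1,4,5]),
       ([0,1,5,4,3],[0,2,1,3,5]),
       ([0,2,5,4,3],[5,4,0,3,1]),
       ([0,3,5,1,4],[5,1,2,5,4]),
       ([0,4,3,1,5],[4,3,5,2,1])],
      [([0,1,2,5,3],[0,1,3,4,5]),
       ([0,1,3,5,2],[0,4,1,3,5]),
       ([0,1,5,3,2],[0,3,4,2,5]),
       ([0,2,1,3,5],[5,1,5,4,3]),
       ([0,2,1,5,3],[3,1,4,0,5])],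
      [([0,2,5,3,4],[5,0,1,3,4]),
       ([0,3,2,4,5],[1,2,5,0,3]),
       ([0,3,2,4,5],[5,2,0,1,3]),
       ([0,3,2,5,4],[5,2,0,1,4]),
       ([0,3,4,2,5],[5,3,5,0,1])],
      [([0,1,3,5,4],[0,5,1,2,4]),
       ([0,1,4,3,5],[0,5,3,1,2]),
       ([0,3,4,1,5],[5,3,2,4,1]),
       ([0,3,5,1,5],[5,1,2,4,3]),
       ([0,3,5,2,4],[1,0,3,5,4])],
      [([0,1,4,2,5],[0,2,5,4,3]),
       ([0,2,4,3,5],[5,0,3,1,2]),
       ([0,2,5,1,4],[3,0,2,5,4]),
       ([0,4,2,1,5],[4,5,1,2,3])],
      [([0,3,4,1,5],[1,3,5,4,2]),
       ([0,3,5,2,4],[5,1,3,0,4]),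
       ([0,4,2,3,5],[4,5,2,0,1]),
       ([0,5,2,5,5],[1,0,4,5,2])],
      [([0,2,1,4,5],[3,1,5,0,2]),
       ([0,2,3,5,4],[5,2,1,0,4]),
       ([0,2,5,3,5],[5,0,1,4,3])],
      [([0,3,1,5,4],[1,5,3,2,4]),
       ([0,4,1,3,5],[4,2,5,1,3]),
       ([0,5,1,3,5],[1,2,5,4,3])],
      [([0,1,2,5,5],[0,1,4,5,2])],
      [([0,1,5,5,4],[0,3,5,1,4])],
      [([0,4,3,5,5],[4,3,0,5,2])]]"

definition codes :: "code list" where
  "codes = concat code_classes"

text \<open>The search accumulates \<open>vs\<close> and \<open>ds\<close> backwards. Only cycles
  with both a new vertex and a new colour need a code, which is looked up in both
  directions.\<close>

definition leaf_ok :: "nat list \<Rightarrow> nat list \<Rightarrow> bool" where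
  "leaf_ok vs ds = (let V = map (min 5) vs; W = map (min 5) ds in
     if list_all (\<lambda>x. x < 5) V then True
     else if list_all (\<lambda>x. x < 5) W then True
     else if List.member codes (rev V, rev W) then True else List.member codes (last V # butlast V, W))"

text \<open>\<open>k\<close> vertices are still to be chosen before the walk closes up at vertex 0.
  The label \<open>length s\<close> stands for a new vertex and gets an empty entry.\<close>

primrec search :: "adjs \<Rightarrow> nat \<Rightarrow> nat \<Rightarrow> nat list \<Rightarrow> nat list \<Rightarrow> bool" where
  "search s m 0 vs ds = list_all (\<lambda>(d, s'). leaf_ok vs (d # ds)) (extensions s m (hd vs) 0 ds)"
| "search s m (Suc k) vs ds = list_all (\<lambda>b. if List.member vs b then True else
      list_all (\<lambda>(d, s'). search s' (max m (Suc d)) k (b # vs) (d # ds))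
        (extensions (if b = length s then s @ [[]] else s) m (hd vs) b ds)) [0..<Suc (length s)]"

definition C5 :: adjs where
  "C5 = [[(1,0),(4,4)],[(2,1),(0,0)],[(3,2),(1,1)],[(4,3),(2,2)],[(0,4),(3,3)]]"

text \<open>Reconstructing the cycle from its code: proceed forwards to the second and third vertex, backwards
  to the last one, and reach the fourth from either side.\<close>

fun determined_code :: "code \<Rightarrow> bool" where
  "determined_code ([a,b,c,d,e],[v,w,x,y,z]) = ((b < 5 \<or> v < 5) \<and> (c < 5 \<or> w < 5) \<and> (e < 5 \<or> z < 5) \<and> (d < 5 \<or> x < 5 \<or> y < 5))"
| "determined_code _ = False"

text \<open>The ten walks with two edges along the cycle, five in each direction, written as vertex,
  colour, vertex, colour, vertex.\<close>

fun two_walks :: "'v list \<times> 'x list \<Rightarrow> ('v \<times> 'x \<times> 'v \<times> 'x \<times> 'v) list" where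
  "two_walks ([a,b,c,d,e],[v,w,x,y,z]) =
    [(a,v,b,w,c), (b,w,c,x,d), (c,x,d,y,e), (d,y,e,z,a), (e,z,a,v,b),
     (c,w,b,v,a), (d,x,c,w,b), (e,y,d,x,c), (a,z,e,y,d), (b,v,a,z,e)]"
| "two_walks _ = []"

text \<open>In a proper colouring two edges at one vertex have the same colour iff they have the
  same other end; a clash violates this at the first or second step from a common start. Different
  labels always mean different objects, equal labels mean equal objects only below 5.\<close>

fun clash :: "nat \<times> nat \<times> nat \<times> nat \<times> nat \<Rightarrow> nat \<times> nat \<times> nat \<times> nat \<times> nat \<Rightarrow> bool" where
  "clash (a,x,b,y,c) (a',x',b',y',c') \<longleftrightarrow>
     (if a = a' \<and> a < 5 then
        if x = x' then x < 5 \<and> (b \<noteq> b' \<or> y = y' \<and> y < 5 \<and> c \<noteq> c' \<or> c = c' \<and> c < 5 \<and> y \<noteq> y')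
        else b = b' \<and> b < 5
      else False)"

definition conflict :: "code \<Rightarrow> code \<Rightarrow> bool" where
  "conflict k l = list_ex (\<lambda>t. list_ex (clash t) (two_walks l)) (two_walks k)"

lemma list_all_determined: "list_all determined_code codes"
  by code_simp

lemma code_classes_conflict: "list_all (sorted_wrt conflict) code_classes"
  by code_simp

lemma length_code_classes: "length code_classes = 17"
  by code_simp

text \<open>The exhaustive search itself, by evaluation: 5 is the first free colour name, and four
  vertices follow the start 0.\<close>

lemma search_C5: "search C5 5 4 [0] []"
  by code_simp

section \<open>Soundness of the search\<close>

text \<open>An interpretation of the names by actual vertices and colours. A state is partial: edges
  it does not record may still be present.\<close>

definition realises :: "'a ugraph \<Rightarrow> ('a set \<Rightarrow> 'c) \<Rightarrow> (nat \<Rightarrow> 'a) \<Rightarrow> (nat \<Rightarrow> 'c) \<Rightarrow> adjs \<Rightarrow> nat \<Rightarrow> bool" where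
  "realises G c f g s m \<longleftrightarrow> inj_on f {..<length s} \<and> inj_on g {..<m} \<and>
    (\<forall>a<length s. \<forall>(b, d)\<in>set (s ! a). b < length s \<and> d < m \<and> (a, d) \<in> set (s ! b) \<and>
        {f a, f b} \<in> edges G \<and> c {f a, f b} = g d)"

lemma realisesD:
  assumes "realises G c f g s m" "a < length s" "(b, d) \<in> set (s ! a)"
  shows "b < length s" "d < m" "(a, d) \<in> set (s ! b)" "{f a, f b} \<in> edges G" "c {f a, f b} = g d"
  using assms unfolding realises_def by blast+

text \<open>The list \<open>ds\<close> only grows, so \<open>d0\<close> passes the final
  filter.\<close>

lemma allowed_keeps: "d0 \<in> set al \<Longrightarrow> d0 \<in> set ds \<Longrightarrow> d0 \<in> set (allowed s k N M vs ds al)"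
proof (induction s k N M vs ds al rule: allowed.induct)
  case (4 s k u d N M vs ds al)
  then show ?case
    by (cases "allowed s k (s ! u) M (u # vs) (d # ds) al") (auto simp: List.member_iff)
qed (auto simp: List.member_iff)

context rainbow_P5_free
begin

text \<open>The list \<open>p\<close> is the actual path made of the two grown paths and the edge of
  colour \<open>d0\<close> between them; \<open>x\<close> and \<open>y\<close> name its ends. Were
  \<open>d0\<close> filtered out, \<open>p\<close> would have become a rainbow path with five
  edges.\<close>

lemma allowed_sound:
  assumes "realises G c f g s m" "d0 < m" "d0 \<in> set al"
    and "x < length s" "set N \<subseteq> set (s ! x)" "M \<noteq> [] \<Longrightarrow> y < length s \<and> set M \<subseteq> set (s ! y)"
    and "set vs \<subseteq> {..<length s}" "set ds \<subseteq> {..<m}"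
    and "rainbow_path G c p" "p \<noteq> []" "length p + k = 6" "hd p = f x" "last p = f y"
    and "set p = f ` set vs" "set (cols c p) = g ` insert d0 (set ds)"
  shows "d0 \<in> set (allowed s k N M vs ds al)"
  using assms
proof (induction s k N M vs ds al arbitrary: x y p rule: allowed.induct)
  case (1 s N M vs ds al)
  \<comment> \<open>Here \<open>p\<close> has six vertices, which contradicts
    \<open>P5_free\<close>.\<close>
  then show ?case using rainbow_path_copy[OF _ _ simple] P5_free by fastforce
next
  case (2 s k vs ds al)
  then show ?case by simp
next
  case (3 s k e M vs ds al)
  have "d0 \<in> set (allowed s (Suc k) (e # M) [] vs ds al)"
    \<comment> \<open>Growth moves to the other end of the path by reversing it.\<close>
    by (rule "3.IH"[of y x "rev p"])
       (use "3.prems" in \<open>auto simp: rainbow_path_rev hd_rev last_rev cols_rev\<close>)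
  then show ?case by simp
next
  case (4 s k u d N M vs ds al)
  have ud: "u < length s" "d < m" "(x, d) \<in> set (s ! u)" "{f x, f u} \<in> edges G" "c {f x, f u} = g d"
    using realisesD[OF "4.prems"(1,4), of u d] "4.prems"(5) by auto
  have inj: "inj_on f {..<length s}" "inj_on g {..<m}" using "4.prems"(1) by (auto simp: realises_def)
  consider "d \<in> set ds" | "d \<notin> set ds" "u \<in> set vs" | "d \<notin> set ds" "u \<notin> set vs" by blast
  then show ?case
  proof cases
    case 1
    have "d0 \<in> set (allowed s (Suc k) N M vs ds al)"
      by (rule "4.IH"(1)[of x y p]) (use 1 "4.prems" in \<open>auto simp: List.member_iff\<close>)
    then show ?thesis using 1 by (simp add: List.member_iff)
  next
    case 2
    have "d0 \<in> set (allowed s (Suc k) N M vs ds al)"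
      by (rule "4.IH"(2)[of x y p]) (use 2 "4.prems" in \<open>auto simp: List.member_iff\<close>)
    then show ?thesis using 2 by (simp add: List.member_iff)
  next
    case 3
    have *: "d0 \<in> set (allowed s k (s ! u) M (u # vs) (d # ds) al)"
    proof (cases "d = d0")
      case True
      \<comment> \<open>The edge to \<open>u\<close> repeats the candidate colour, so the longer
        path is not rainbow, but \<open>d0\<close> is now in the list of used colours and is
        kept.\<close>
      then show ?thesis using "4.prems" by (intro allowed_keeps) auto
    next
      case False
      obtain p' where p: "p = f x # p'" using "4.prems"(10,12) by (cases p) auto
      have "f u \<notin> set p"
        using 3 ud(1) "4.prems"(7,14) inj(1) by (auto dest: inj_onD)
      moreover have "g d \<notin> set (cols c p)"
        using 3 ud(2) "4.prems"(2,8,15) inj(2) False by (auto dest: inj_onD)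
      ultimately have "rainbow_path G c (f u # p)"
        using "4.prems"(9) ud(4,5) unfolding rainbow_path_def p by (simp add: insert_commute)
      moreover have "set (cols c (f u # p)) = g ` insert d0 (set (d # ds))"
        using "4.prems"(15) ud(5) unfolding p by (auto simp: insert_commute)
      ultimately show ?thesis
        using 3 ud "4.prems"
        by (intro "4.IH"(3)[of u y "f u # p"]) (auto simp: List.member_iff)
    qed
    then obtain a al' where al': "allowed s k (s ! u) M (u # vs) (d # ds) al = a # al'"
      by (cases "allowed s k (s ! u) M (u # vs) (d # ds) al") auto
    have "d0 \<in> set (allowed s (Suc k) N M vs ds (a # al'))"
      by (rule "4.IH"(4)[of a al' x y p]) (use 3 * al' "4.prems" in \<open>auto simp: List.member_iff\<close>)
    then show ?thesis using 3 al' by (simp add: List.member_iff)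
  qed
qed

end

text \<open>The vertex \<open>y\<close> either has a name already or receives the fresh name
  \<open>length s\<close>; \<open>search\<close> tries both kinds.\<close>

lemma realises_add_vertex:
  assumes "realises G c f g s m"
  obtains b f' where "b \<le> length s" "f' b = y" "\<forall>i<length s. f' i = f i"
    "realises G c f' g (if b = length s then s @ [[]] else s) m"
proof (cases "y \<in> f ` {..<length s}")
  case True
  then obtain b where "b < length s" "f b = y" by blast
  then show ?thesis using assms by (intro that[of b f]) auto
next
  case False
  let ?f = "f(length s := y)"
  have "realises G c ?f g (s @ [[]]) m"
    unfolding realises_def
  proof (intro conjI allI impI ballI)
    show "inj_on ?f {..<length (s @ [[]])}"
      using assms False unfolding realises_def
      by (auto simp: lessThan_Suc inj_on_fun_updI)
    show "inj_on g {..<m}" using assms by (simp add: realises_def)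
    fix a e assume a: "a < length (s @ [[]])" "e \<in> set ((s @ [[]]) ! a)"
    obtain b d where e: "e = (b, d)" by (cases e)
    have "a < length s" using a by (cases "a = length s") auto
    with a e realisesD[OF assms this, of b d]
    show "case e of (b, d) \<Rightarrow> b < length (s @ [[]]) \<and> d < m \<and> (a, d) \<in> set ((s @ [[]]) ! b) \<and>
        {?f a, ?f b} \<in> edges G \<and> c {?f a, ?f b} = g d"
      by (auto simp: nth_append)
  qed
  then show ?thesis by (intro that[of "length s" ?f]) auto
qed

context rainbow_P5_free
begin

text \<open>The true colour of the edge is named, freshly if necessary, and survives: properness
  covers the colours seen at \<open>a\<close> and \<open>b\<close>, \<open>allowed_sound\<close> the
  rest.\<close>

lemma extensions_sound:
  assumes R: "realises G c f g s m" and ab: "a < length s" "b < length s" "a \<noteq> b"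
    and E: "{f a, f b} \<in> edges G" and ds: "c {f a, f b} \<notin> g ` set ds" "set ds \<subseteq> {..<m}"
  obtains d s' g' where "(d, s') \<in> set (extensions s m a b ds)" "g' d = c {f a, f b}"
    "\<forall>i<m. g' i = g i" "length s' = length s" "realises G c f g' s' (max m (Suc d))"
proof (cases "map_of (s ! a) b")
  case (Some d)
  then have d: "(b, d) \<in> set (s ! a)" by (rule map_of_SomeD)
  then have "g d = c {f a, f b}" "d < m" "d \<notin> set ds"
    using realisesD[OF R ab(1) d] ds(1) by (auto simp: image_iff)
  then show ?thesis
    using R Some by (intro that[of d s g]) (auto simp: extensions_def List.member_iff max_absorb1)
next
  case None
  let ?z = "c {f a, f b}"
  have inj: "inj_on f {..<length s}" "inj_on g {..<m}" using R by (auto simp: realises_def)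
  obtain d g' where d: "d \<le> m" "g' d = ?z" "\<forall>i<m. g' i = g i" "inj_on g' {..<max m (Suc d)}"
  proof (cases "?z \<in> g ` {..<m}")
    case True
    then obtain d where "d < m" "g d = ?z" by auto
    then show ?thesis using inj(2) by (intro that[of d g]) (auto simp: max_absorb1)
  next
    case False
    then show ?thesis using inj(2)
      by (intro that[of m "g(m := ?z)"]) (auto simp: max_def lessThan_Suc inj_on_fun_updI)
  qed
  let ?m = "max m (Suc d)"
  have R': "realises G c f g' s ?m"
    using R d(3,4) unfolding realises_def by fastforce
  \<comment> \<open>A recorded edge of this colour at \<open>a\<close> would be the edge to
    \<open>b\<close> itself by properness, but that edge is not recorded.\<close>
  have ne: "(w, d) \<notin> set (s ! a)" for w
  proof
    assume w: "(w, d) \<in> set (s ! a)"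
    note * = realisesD[OF R' ab(1) w]
    have "{f a, f w} = {f a, f b}"
      using proper *(4,5) E d(2) unfolding proper_edge_coloring_def by fastforce
    then have "w = b" using inj(1) *(1) ab by (auto simp: doubleton_eq_iff inj_on_def)
    then show False using w None by (metis map_of_eq_None_iff fst_conv image_eqI)
  qed
  have ne': "(w, d) \<notin> set (s ! b)" for w
  proof
    assume w: "(w, d) \<in> set (s ! b)"
    note * = realisesD[OF R' ab(2) w]
    have "{f b, f w} = {f a, f b}"
      using proper *(4,5) E d(2) unfolding proper_edge_coloring_def by fastforce
    then have "w = a" using inj(1) *(1) ab by (auto simp: doubleton_eq_iff inj_on_def)
    then show False using *(3) None by (metis map_of_eq_None_iff fst_conv image_eqI)
  qed
  have "d \<notin> set ds" using ds d(2,3) by (metis image_eqI lessThan_iff subsetD)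
  \<comment> \<open>The initial path is the edge alone: two vertices, four edges to come.\<close>
  then have "d \<in> set (allowed s 4 (s ! a) (s ! b) [a, b] []
      (filter (\<lambda>d. \<not> List.member (ds @ map snd (s ! a) @ map snd (s ! b)) d) [0..<Suc m]))"
    using d ab E ne ne' inj
    by (intro allowed_sound[OF R', where x = a and y = b and p = "[f a, f b]"])
       (auto simp: List.member_iff rainbow_path_def dest: inj_onD)
  moreover have "realises G c f g' (s[a := (b, d) # s ! a, b := (a, d) # s ! b]) ?m"
    unfolding realises_def
  proof (intro conjI allI impI ballI)
    let ?s = "s[a := (b, d) # s ! a, b := (a, d) # s ! b]"
    show "inj_on f {..<length ?s}" using inj by simp
    show "inj_on g' {..<?m}" by (fact d(4))
    fix i e assume i: "i < length ?s" "e \<in> set (?s ! i)"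
    obtain j k where e: "e = (j, k)" by (cases e)
    show "case e of (b, d) \<Rightarrow> b < length ?s \<and> d < ?m \<and> (i, d) \<in> set (?s ! b) \<and>
        {f i, f b} \<in> edges G \<and> c {f i, f b} = g' d"
    proof (cases "(j, k) \<in> set (s ! i)")
      case True
      with i realisesD[OF R' _ True] ab show ?thesis by (auto simp: e nth_list_update)
    next
      case False
      then have "i = a \<and> j = b \<and> k = d \<or> i = b \<and> j = a \<and> k = d"
        using i ab by (auto simp: e nth_list_update split: if_splits)
      then show ?thesis using ab E d(2) by (auto simp: e nth_list_update insert_commute)
    qed
  qed
  ultimately show ?thesis
    using None d by (intro that[of d _ g']) (auto simp: extensions_def)
qed

text \<open>An actual cycle steers the search: its next vertex and edge colour are among the tried
  names, so some leaf records it. \<open>ys\<close> are the vertices still to come, and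
  \<open>hd vs = 0 \<longrightarrow> 0 < k\<close> keeps the closing edge from being a loop.\<close>

lemma search_sound:
  assumes "search s m k vs ds" "realises G c f g s m" "vs \<noteq> []" "0 < length s"
    and "set vs \<subseteq> {..<length s}" "set ds \<subseteq> {..<m}" "0 \<in> set vs" "hd vs = 0 \<longrightarrow> 0 < k"
    and "length ys = k" "distinct ys" "set ys \<inter> f ` set vs = {}"
    and "successively (\<lambda>u v. {u, v} \<in> edges G) (f (hd vs) # ys @ [f 0])"
    and "distinct (cols c (f (hd vs) # ys @ [f 0]))"
    and "set (cols c (f (hd vs) # ys @ [f 0])) \<inter> g ` set ds = {}"
  shows "\<exists>vs' ds' f' g' n' m'. leaf_ok (vs' @ vs) (ds' @ ds) \<and>
    length s \<le> n' \<and> m \<le> m' \<and> inj_on f' {..<n'} \<and> inj_on g' {..<m'} \<and>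
    (\<forall>i<length s. f' i = f i) \<and> (\<forall>i<m. g' i = g i) \<and> set vs' \<subseteq> {..<n'} \<and> set ds' \<subseteq> {..<m'} \<and>
    map f' vs' = rev ys \<and> map g' ds' = rev (cols c (f (hd vs) # ys @ [f 0]))"
  using assms
proof (induction k arbitrary: s m vs ds f g ys)
  case 0
  let ?a = "hd vs"
  have a: "?a < length s" using "0.prems" by (cases vs) auto
  obtain d s' g' where d: "(d, s') \<in> set (extensions s m ?a 0 ds)" "g' d = c {f ?a, f 0}"
    "\<forall>i<m. g' i = g i" "length s' = length s" "realises G c f g' s' (max m (Suc d))"
    by (rule extensions_sound[OF "0.prems"(2) a "0.prems"(4)]) (use "0.prems" in auto)
  have "leaf_ok vs (d # ds)" using "0.prems"(1) d(1) by (auto simp: list_all_iff)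
  then show ?case
    using d "0.prems" 
    by (intro exI[of _ "[]"] exI[of _ "[d]"] exI[of _ f] exI[of _ g'] exI[of _ "length s"]
          exI[of _ "max m (Suc d)"]) (auto simp: realises_def)
next
  case (Suc k)
  let ?a = "hd vs"
  have a: "?a < length s" "?a \<in> set vs" using Suc.prems by (cases vs; auto)+
  obtain y ys' where ys: "ys = y # ys'" "length ys' = k" using Suc.prems(9) by (cases ys) auto
  obtain b f1 where b: "b \<le> length s" "f1 b = y" "\<forall>i<length s. f1 i = f i"
    "realises G c f1 g (if b = length s then s @ [[]] else s) m"
    by (rule realises_add_vertex[OF Suc.prems(2)])
  let ?s = "if b = length s then s @ [[]] else s"
  have fvs: "f1 ` set vs = f ` set vs"
    using b(3) Suc.prems(5) by (intro image_cong) auto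
  then have bvs: "b \<notin> set vs" using Suc.prems(11) b(2) ys by auto
  have f1a: "f1 ?a = f ?a" "f1 0 = f 0" using a b Suc.prems(4) by auto
  have E: "{f ?a, y} \<in> edges G" using Suc.prems(12) ys by (cases ys') auto
  have colsys: "cols c (f ?a # ys @ [f 0]) = c {f ?a, y} # cols c (y # ys' @ [f 0])"
    using ys by simp
  obtain d s' g' where d: "(d, s') \<in> set (extensions ?s m ?a b ds)" "g' d = c {f1 ?a, f1 b}"
    "\<forall>i<m. g' i = g i" "length s' = length ?s" "realises G c f1 g' s' (max m (Suc d))"
    by (rule extensions_sound[OF b(4), of ?a b ds])
       (use Suc.prems a b bvs E f1a colsys in \<open>auto split: if_splits\<close>)
  have gds: "g' ` set ds = g ` set ds" using d(3) Suc.prems(6) by (intro image_cong) auto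
  have "search s' (max m (Suc d)) k (b # vs) (d # ds)"
  proof -
    have "list_all (\<lambda>(d, s'). search s' (max m (Suc d)) k (b # vs) (d # ds)) (extensions ?s m ?a b ds)"
      using Suc.prems(1) b(1) bvs unfolding search.simps list_all_iff[of _ "[0..<Suc (length s)]"]
      by (simp only: List.member_iff if_False if_True) (drule bspec[of _ _ b]; auto)
    then show ?thesis using d(1) by (auto simp: list_all_iff)
  qed
  moreover have "successively (\<lambda>u v. {u, v} \<in> edges G) (f1 (hd (b # vs)) # ys' @ [f1 0])"
    using Suc.prems(12) b(2) f1a ys by (simp add: successively_Cons)
  moreover have "distinct (cols c (f1 (hd (b # vs)) # ys' @ [f1 0]))"
    "set (cols c (f1 (hd (b # vs)) # ys' @ [f1 0])) \<inter> g' ` set (d # ds) = {}"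
    using Suc.prems(13,14) gds d(2) b(2) f1a unfolding colsys by auto
  moreover have "set ys' \<inter> f1 ` set (b # vs) = {}"
    using Suc.prems(10,11) fvs b(2) ys by auto
  moreover have "hd (b # vs) = 0 \<longrightarrow> 0 < k" using bvs Suc.prems(7) by auto
  moreover have "set (b # vs) \<subseteq> {..<length s'}" "set (d # ds) \<subseteq> {..<max m (Suc d)}" "0 < length s'"
    using Suc.prems(4-6) d(4) b(1) by (auto split: if_splits)
  ultimately obtain vs' ds' f' g'' n' m' where *: "leaf_ok (vs' @ b # vs) (ds' @ d # ds)"
    "length s' \<le> n'" "max m (Suc d) \<le> m'" "inj_on f' {..<n'}" "inj_on g'' {..<m'}"
    "\<forall>i<length s'. f' i = f1 i" "\<forall>i<max m (Suc d). g'' i = g' i"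
    "set vs' \<subseteq> {..<n'}" "set ds' \<subseteq> {..<m'}" "map f' vs' = rev ys'"
    "map g'' ds' = rev (cols c (f1 (hd (b # vs)) # ys' @ [f1 0]))"
    using Suc.IH[of s' "max m (Suc d)" "b # vs" "d # ds" f1 g' ys'] d(5) ys Suc.prems(7,10) by auto
  have len: "length s \<le> length s'" "b < length s'" using d(4) b(1) by auto
  show ?case
    using * len b(2,3) d(2,3) f1a ys colsys
    by (intro exI[of _ "vs' @ [b]"] exI[of _ "ds' @ [d]"] exI[of _ f'] exI[of _ g''] exI[of _ n'] exI[of _ m'])
       auto
qed

end

section \<open>Codes of cycles relative to a given cycle\<close>

definition lab :: "'x list \<Rightarrow> 'x \<Rightarrow> nat \<Rightarrow> bool" where
  "lab xs y l \<longleftrightarrow> l \<le> 5 \<and> (if l < 5 then y = xs ! l else y \<notin> set xs)"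

definition described :: "('a set \<Rightarrow> 'c) \<Rightarrow> 'a list \<Rightarrow> 'a list \<Rightarrow> code \<Rightarrow> bool" where
  "described c p q k \<longleftrightarrow> list_all2 (lab p) q (fst k) \<and>
     list_all2 (lab (cycle_cols c p)) (cycle_cols c q) (snd k)"

text \<open>Names 0 to 4 exhaust \<open>xs\<close> and \<open>f\<close> is injective, so every later
  name lies off \<open>xs\<close> and may be collapsed to 5.\<close>

lemma lab_min:
  assumes "length xs = 5" "inj_on f {..<n}" "5 \<le> n" "\<forall>i<5. f i = xs ! i" "i < n"
  shows "lab xs (f i) (min 5 i)"
proof (cases "i < 5")
  case False
  have "f i \<noteq> f j" if "j < 5" for j
    using that False assms(2,3,5) by (auto dest!: inj_onD)
  then have "f i \<noteq> xs ! j" if "j < 5" for j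
    using that assms(4) by metis
  then have "f i \<notin> set xs"
    using assms(1) by (metis in_set_conv_nth)
  then show ?thesis using False by (simp add: lab_def)
qed (use assms in \<open>auto simp: lab_def\<close>)

lemma lab_list:
  assumes "length xs = 5" "inj_on f {..<n}" "5 \<le> n" "\<forall>i<5. f i = xs ! i" "set is \<subseteq> {..<n}"
  shows "list_all2 (lab xs) (map f is) (map (min 5) is)"
  using assms(5) by (induction "is") (auto intro: lab_min[OF assms(1-4)])

lemma lab_small:
  assumes "list_all2 (lab xs) ys ls" "\<forall>l\<in>set ls. l < 5" "length xs = 5"
  shows "set ys \<subseteq> set xs"
  using assms by (induction rule: list_all2_induct) (auto simp: lab_def)

lemma leaf_ok_cases:
  assumes "leaf_ok vs ds" "\<not> (\<forall>l\<in>set (map (min 5) vs). l < 5)" "\<not> (\<forall>l\<in>set (map (min 5) ds). l < 5)"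
  shows "(rev (map (min 5) vs), rev (map (min 5) ds)) \<in> set codes \<or>
    (last (map (min 5) vs) # butlast (map (min 5) vs), map (min 5) ds) \<in> set codes"
  using assms unfolding leaf_ok_def Let_def list_all_iff List.member_iff
  by (simp only: if_False split: if_splits) blast+

context rainbow_P5_free
begin

text \<open>The search follows \<open>q\<close> to a leaf. As \<open>q\<close> has a vertex and a
  colour off \<open>p\<close>, the leaf passes only because the code of \<open>q\<close> or of
  \<open>reflect q\<close> is listed.\<close>

lemma cycle_described:
  assumes p: "rainbow_cycle G c p" and q: "rainbow_cycle G c q" and pq: "hd q = hd p"
    and V: "\<not> set q \<subseteq> set p" and S: "\<not> set (cycle_cols c q) \<subseteq> set (cycle_cols c p)"
  obtains q' k where "rainbow_cycle G c q'" "hd q' = hd p" "cyc q' = cyc q" "k \<in> set codes"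
    "described c p q' k"
proof -
  obtain x y z t w where p5: "p = [x,y,z,t,w]" using rainbow_cycleE[OF p] .
  obtain a y' z' t' w' where "q = [a,y',z',t',w']" using rainbow_cycleE[OF q] .
  then obtain ys where q5: "q = a # ys" "length ys = 4" "a = x" using pq p5 by simp
  let ?f = "(!) p" and ?g = "(!) (cycle_cols c p)"
  have len: "length p = 5" "length (cycle_cols c p) = 5" by (simp_all add: p5 cycle_cols_5)
  have inj: "inj_on ?f {..<5}" "inj_on ?g {..<5}"
    using p unfolding p5 rainbow_cycle_5 cycle_cols_5 by (auto intro!: inj_on_nth)
  have "realises G c ?f ?g C5 5"
  proof -
    have l: "length C5 = 5" by (simp add: C5_def)
    have "\<forall>a\<in>{..<5}. \<forall>(b, d)\<in>set (C5 ! a). b < 5 \<and> d < 5 \<and> (a, d) \<in> set (C5 ! b) \<and>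
        {?f a, ?f b} \<in> edges G \<and> c {?f a, ?f b} = ?g d"
      using p unfolding lessThan_5 p5 rainbow_cycle_5 cycle_cols_5 C5_def
      by (simp add: insert_commute)
    then show ?thesis unfolding realises_def l using inj by auto
  qed
  moreover have "cols c (?f (hd [0]) # ys @ [?f 0]) = cycle_cols c q"
    using q5 p5 by (simp add: cycle_cols_def)
  ultimately obtain vs' ds' f' g' n' m' where *: "leaf_ok (vs' @ [0]) (ds' @ [])"
    "length C5 \<le> n'" "5 \<le> m'" "inj_on f' {..<n'}" "inj_on g' {..<m'}"
    "\<forall>i<length C5. f' i = ?f i" "\<forall>i<5. g' i = ?g i" "set vs' \<subseteq> {..<n'}" "set ds' \<subseteq> {..<m'}"
    "map f' vs' = rev ys" "map g' ds' = rev (cycle_cols c q)"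
    using search_sound[OF search_C5, of ?f ?g ys] q p5 q5
    by (auto simp: C5_def rainbow_cycle_def cycle_cols_def)
  have n': "5 \<le> n'" "\<forall>i<5. f' i = ?f i" using *(2,6) by (auto simp: C5_def)
  let ?V = "map (min 5) vs'" and ?W = "map (min 5) ds'"
  have lV: "list_all2 (lab p) (rev ys) ?V"
    using lab_list[OF len(1) *(4) n' *(8)] *(10) by simp
  have l0: "lab p a 0" using p5 q5 by (simp add: lab_def)
  have lW: "list_all2 (lab (cycle_cols c p)) (rev (cycle_cols c q)) ?W"
    using lab_list[OF len(2) *(5,3,7,9)] *(11) by simp
  have "\<not> (\<forall>l\<in>set (map (min 5) (vs' @ [0])). l < 5)"
    using lab_small[OF lV _ len(1)] V q5 p5 by auto
  moreover have "\<not> (\<forall>l\<in>set (map (min 5) (ds' @ [])). l < 5)"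
    using lab_small[OF lW _ len(2)] S by auto
  ultimately consider "(0 # rev ?V, rev ?W) \<in> set codes" | "(0 # ?V, ?W) \<in> set codes"
    using leaf_ok_cases[OF *(1)] by auto
  then show ?thesis
  proof cases
    case 1
    have "described c p q (0 # rev ?V, rev ?W)"
      using lV lW l0 q5 by (simp add: described_def list_all2_rev1)
    then show ?thesis using that q pq 1 by blast
  next
    case 2
    have "described c p (reflect q) (0 # ?V, ?W)"
      using lV lW l0 q5 reflect(5)[OF q] by (simp add: described_def reflect_def)
    then show ?thesis using that reflect[OF q] pq 2 by metis
  qed
qed

end

section \<open>Conflicting codes, and uniqueness of the cycle with a given code\<close>

lemma lab_unique: "lab xs y l \<Longrightarrow> lab xs y l' \<Longrightarrow> distinct xs \<Longrightarrow> length xs = 5 \<Longrightarrow> l = l'"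
  by (auto simp: lab_def nth_eq_iff_index_eq split: if_splits)

lemma lab_same: "lab xs y l \<Longrightarrow> lab xs y' l \<Longrightarrow> l < 5 \<Longrightarrow> y = y'"
  by (auto simp: lab_def)

lemma described_walks:
  assumes "described c p q k" "rainbow_cycle G c q" "(a,x,b,y,d) \<in> set (two_walks k)"
  obtains u z v z' w where "lab p u a" "lab (cycle_cols c p) z x" "lab p v b"
    "lab (cycle_cols c p) z' y" "lab p w d"
    "{u,v} \<in> edges G" "c {u,v} = z" "{v,w} \<in> edges G" "c {v,w} = z'"
proof -
  obtain q0 q1 q2 q3 q4 where q: "q = [q0,q1,q2,q3,q4]" using rainbow_cycleE[OF assms(2)] .
  obtain V W where k: "k = (V, W)" by (cases k)
  have "list_all2 (lab p) q V" "list_all2 (lab (cycle_cols c p)) (cycle_cols c q) W"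
    using assms(1) by (simp_all add: described_def k)
  then obtain v0 v1 v2 v3 v4 w0 w1 w2 w3 w4 where VW: "V = [v0,v1,v2,v3,v4]" "W = [w0,w1,w2,w3,w4]"
    and L: "lab p q0 v0" "lab p q1 v1" "lab p q2 v2" "lab p q3 v3" "lab p q4 v4"
      "lab (cycle_cols c p) (c {q0,q1}) w0" "lab (cycle_cols c p) (c {q1,q2}) w1"
      "lab (cycle_cols c p) (c {q2,q3}) w2" "lab (cycle_cols c p) (c {q3,q4}) w3"
      "lab (cycle_cols c p) (c {q4,q0}) w4"
    unfolding q cycle_cols_5 by (auto simp: list_all2_Cons1)
  have E: "{q0,q1} \<in> edges G" "{q1,q2} \<in> edges G" "{q2,q3} \<in> edges G" "{q3,q4} \<in> edges G"
    "{q4,q0} \<in> edges G" using assms(2) unfolding q rainbow_cycle_5 by auto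
  define Q where "Q = (\<lambda>(a, x, b, y, d). \<exists>u v w. lab p u a \<and> lab p v b \<and> lab p w d \<and>
    {u,v} \<in> edges G \<and> {v,w} \<in> edges G \<and> lab (cycle_cols c p) (c {u,v}) x \<and> lab (cycle_cols c p) (c {v,w}) y)"
  have Q: "Q (a, x, b, y, d)" if "lab p u a" "lab p v b" "lab p w d" "{u,v} \<in> edges G" "{v,w} \<in> edges G"
    "lab (cycle_cols c p) (c {u,v}) x" "lab (cycle_cols c p) (c {v,w}) y" for a x b y d u v w
    using that unfolding Q_def by blast
  have sym: "{v,u} \<in> edges G" "lab (cycle_cols c p) (c {v,u}) x"
    if "{u,v} \<in> edges G" "lab (cycle_cols c p) (c {u,v}) x" for u v x
    using that by (simp_all add: insert_commute)
  \<comment> \<open>The reversed edges serve the walks against the orientation of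
    \<open>q\<close>.\<close>
  note S = sym[OF E(1) L(6)] sym[OF E(2) L(7)] sym[OF E(3) L(8)] sym[OF E(4) L(9)] sym[OF E(5) L(10)]
  have "\<forall>t\<in>set (two_walks k). Q t"
    unfolding k VW two_walks.simps list.set ball_simps
    by (intro conjI TrueI; rule Q, (rule L E S)+)
  then show ?thesis using assms(3) that unfolding Q_def by fastforce
qed

context rainbow_P5_free
begin

lemma proper_unique:
  assumes "{u, v} \<in> edges G" "{u, w} \<in> edges G" "c {u, v} = c {u, w}"
  shows "v = w"
proof -
  have "{u, v} \<inter> {u, w} \<noteq> {}" by simp
  then have "{u, v} = {u, w}" using proper[unfolded proper_edge_coloring_def, rule_format, OF assms(1,2)] assms(3)
    by metis
  then show ?thesis by (auto simp: doubleton_eq_iff)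
qed

text \<open>The walks of a clash leave the same vertex of \<open>p\<close>. Equal known colours
  force equal neighbours and equal neighbours force equal colours, so some object would carry two
  labels.\<close>

lemma conflict_False:
  assumes p: "rainbow_cycle G c p"
    and "rainbow_cycle G c q" "described c p q k" "rainbow_cycle G c q'" "described c p q' k'"
    and "conflict k k'"
  shows False
proof -
  obtain x0 x1 x2 x3 x4 where "p = [x0,x1,x2,x3,x4]" using rainbow_cycleE[OF p] .
  then have d: "distinct p" "distinct (cycle_cols c p)" "length p = 5" "length (cycle_cols c p) = 5"
    using p by (simp_all add: rainbow_cycle_5 cycle_cols_5)
  note un = lab_unique[OF _ _ d(1,3)] lab_unique[OF _ _ d(2,4)]
  obtain t t' where tt: "t \<in> set (two_walks k)" "t' \<in> set (two_walks k')" "clash t t'"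
    using assms(6) by (auto simp: conflict_def list_ex_iff)
  obtain a x b y e where t: "t = (a,x,b,y,e)" by (cases t)
  obtain a' x' b' y' e' where t': "t' = (a',x',b',y',e')" by (cases t')
  obtain u z v z' w where 1: "lab p u a" "lab (cycle_cols c p) z x" "lab p v b"
    "lab (cycle_cols c p) z' y" "lab p w e"
    "{u,v} \<in> edges G" "c {u,v} = z" "{v,w} \<in> edges G" "c {v,w} = z'"
    using described_walks[OF assms(3,2) tt(1)[unfolded t]] .
  obtain u2 z2 v2 z2' w2 where 2: "lab p u2 a'" "lab (cycle_cols c p) z2 x'" "lab p v2 b'"
    "lab (cycle_cols c p) z2' y'" "lab p w2 e'"
    "{u2,v2} \<in> edges G" "c {u2,v2} = z2" "{v2,w2} \<in> edges G" "c {v2,w2} = z2'"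
    using described_walks[OF assms(5,4) tt(2)[unfolded t']] .
  have a: "a = a'" "a < 5" using tt(3) unfolding t t' by (auto split: if_splits)
  have u: "u2 = u" using lab_same[OF 2(1) 1(1)[unfolded a(1)]] a by simp
  show False
  proof (cases "x = x'")
    case False
    then have b: "b = b'" "b < 5" using tt(3) a unfolding t t' by auto
    then have "v2 = v" using lab_same 1(3) 2(3) by metis
    then have "x = x'" using un(2) 1(2,7) 2(2,7) u by simp
    then show False using False by simp
  next
    case True
    then have x: "x < 5" and *: "b \<noteq> b' \<or> y = y' \<and> y < 5 \<and> e \<noteq> e' \<or> e = e' \<and> e < 5 \<and> y \<noteq> y'"
      using tt(3) a unfolding t t' by auto
    have "z2 = z" using lab_same 1(2) 2(2) True x by metis
    then have v: "v2 = v" using proper_unique 1(6,7) 2(6,7) u by metis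
    then have "b = b'" using un(1) 1(3) 2(3) by simp
    with * consider (colour) "y = y'" "y < 5" "e \<noteq> e'" | (vertex) "e = e'" "e < 5" "y \<noteq> y'" by auto
    then show False
    proof cases
      case colour
      have "z2' = z'" using lab_same 1(4) 2(4) colour by metis
      then have "w2 = w" using proper_unique 1(8,9) 2(8,9) v by metis
      then show False using un(1) 1(5) 2(5) colour by simp
    next
      case vertex
      have "w2 = w" using lab_same 1(5) 2(5) vertex by metis
      then have "y = y'" using un(2) 1(4,9) 2(4,9) v by simp
      then show False using vertex by simp
    qed
  qed
qed

text \<open>Each new vertex is fixed by its own label or, through properness, by the colour of an
  edge from a vertex already fixed.\<close>

lemma determined:
  assumes "rainbow_cycle G c q" "described c p q k" "rainbow_cycle G c q'" "described c p q' k"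
    and "hd q = hd q'" "determined_code k"
  shows "q = q'"
proof -
  obtain q0 q1 q2 q3 q4 where q: "q = [q0,q1,q2,q3,q4]" using rainbow_cycleE[OF assms(1)] .
  obtain r1 r2 r3 r4 where q': "q' = [q0,r1,r2,r3,r4]"
    using rainbow_cycleE[OF assms(3)] assms(5) q by (metis list.sel(1))
  obtain V W where k: "k = (V, W)" by (cases k)
  have "list_all2 (lab p) q V" "list_all2 (lab (cycle_cols c p)) (cycle_cols c q) W"
    "list_all2 (lab p) q' V" "list_all2 (lab (cycle_cols c p)) (cycle_cols c q') W"
    using assms(2,4) by (simp_all add: described_def k)
  then obtain v0 v1 v2 v3 v4 w0 w1 w2 w3 w4 where VW: "V = [v0,v1,v2,v3,v4]" "W = [w0,w1,w2,w3,w4]"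
    and L: "lab p q1 v1" "lab p q2 v2" "lab p q3 v3" "lab p q4 v4"
      "lab (cycle_cols c p) (c {q0,q1}) w0" "lab (cycle_cols c p) (c {q1,q2}) w1"
      "lab (cycle_cols c p) (c {q2,q3}) w2" "lab (cycle_cols c p) (c {q4,q3}) w3"
      "lab (cycle_cols c p) (c {q0,q4}) w4"
    and L': "lab p r1 v1" "lab p r2 v2" "lab p r3 v3" "lab p r4 v4"
      "lab (cycle_cols c p) (c {q0,r1}) w0" "lab (cycle_cols c p) (c {r1,r2}) w1"
      "lab (cycle_cols c p) (c {r2,r3}) w2" "lab (cycle_cols c p) (c {r4,r3}) w3"
      "lab (cycle_cols c p) (c {q0,r4}) w4"
    unfolding q q' cycle_cols_5 by (auto simp: list_all2_Cons1 insert_commute)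
  have E: "{q0,q1} \<in> edges G" "{q1,q2} \<in> edges G" "{q2,q3} \<in> edges G" "{q4,q3} \<in> edges G"
    "{q0,q4} \<in> edges G" using assms(1) unfolding q rainbow_cycle_5 by (auto simp: insert_commute)
  have E': "{q0,r1} \<in> edges G" "{r1,r2} \<in> edges G" "{r2,r3} \<in> edges G" "{r4,r3} \<in> edges G"
    "{q0,r4} \<in> edges G" using assms(3) unfolding q' rainbow_cycle_5 by (auto simp: insert_commute)
  have step: "w = w'" if "l < 5 \<or> l' < 5" "lab p w l" "lab p w' l" "{v, w} \<in> edges G" "{v, w'} \<in> edges G"
    "lab (cycle_cols c p) (c {v, w}) l'" "lab (cycle_cols c p) (c {v, w'}) l'" for v w w' l l'
    using that(1) lab_same[OF that(2,3)] lab_same[OF that(6,7)] proper_unique[OF that(4,5)] by blast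
  have D: "v1 < 5 \<or> w0 < 5" "v2 < 5 \<or> w1 < 5" "v4 < 5 \<or> w4 < 5" "(v3 < 5 \<or> w2 < 5) \<or> (v3 < 5 \<or> w3 < 5)"
    using assms(6) by (auto simp: k VW)
  have 1: "r1 = q1" using step[OF D(1) L(1) L'(1) E(1) E'(1) L(5) L'(5)] by simp
  have 2: "r2 = q2" using step[OF D(2) L(2) L'(2) E(2) E'(2)[unfolded 1] L(6) L'(6)[unfolded 1]] by simp
  have 4: "r4 = q4" using step[OF D(3) L(4) L'(4) E(5) E'(5) L(9) L'(9)] by simp
  \<comment> \<open>This vertex may be reached from \<open>q2\<close> or from
    \<open>q4\<close>.\<close>
  have 3: "r3 = q3"
    using D(4) step[OF _ L(3) L'(3) E(3) E'(3)[unfolded 2] L(7) L'(7)[unfolded 2]]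
      step[OF _ L(3) L'(3) E(4) E'(4)[unfolded 4] L(8) L'(8)[unfolded 4]] by blast
  show ?thesis using 1 2 3 4 q q' by simp
qed

end

section \<open>The upper bound\<close>

text \<open>An isomorphism \<open>f\<close> from the standard cycle is the same as the list of its
  values, so copies can be counted through lists.\<close>

lemma rainbow_copies_C5:
  assumes "simple_graph G"
  shows "rainbow_copies (cycle_graph 5) G c = cyc ` {p. rainbow_cycle G c p}"
proof (intro set_eqI iffI)
  fix K assume "K \<in> rainbow_copies (cycle_graph 5) G c"
  then have K: "subgraph K G" "graph_iso (cycle_graph 5) K" "rainbow c K"
    by (auto simp: rainbow_copies_def)
  then obtain f where f: "bij_betw f {0,1,2,3,4::nat} (verts K)"
    and e: "edges K = (\<lambda>e. f ` e) ` {{0,1},{1,2},{2,3},{3,4},{4,0}}"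
    unfolding graph_iso_def verts_cycle_graph_5 edges_cycle_graph_5 by blast
  let ?p = "[f 0, f 1, f 2, f 3, f 4]"
  have inj: "inj_on f {0,1,2,3,4}" and V: "verts K = f ` {0,1,2,3,4}"
    using f by (auto simp: bij_betw_def)
  have d: "distinct ?p" using inj by (simp add: inj_on_def)
  have E: "edges K = {{f 0,f 1},{f 1,f 2},{f 2,f 3},{f 3,f 4},{f 4,f 0}}"
    unfolding e by simp
  have "K = cyc ?p" unfolding cyc_5 using V E by (cases K) simp
  moreover have "distinct (map c [{f 0,f 1},{f 1,f 2},{f 2,f 3},{f 3,f 4},{f 4,f 0}])"
    using K(3) d unfolding distinct_map rainbow_def E by (simp add: doubleton_eq_iff) metis
  ultimately show "K \<in> cyc ` {p. rainbow_cycle G c p}"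
    using K(1) d E unfolding subgraph_def by (intro image_eqI[of _ _ ?p]) (auto simp: rainbow_cycle_5)
next
  fix K assume "K \<in> cyc ` {p. rainbow_cycle G c p}"
  then obtain p where p: "rainbow_cycle G c p" "K = cyc p" by auto
  obtain x y z t w where p5: "p = [x,y,z,t,w]" using rainbow_cycleE[OF p(1)] .
  have K: "verts K = {x,y,z,t,w}" "edges K = {{x,y},{y,z},{z,t},{t,w},{w,x}}"
    using p(2) by (simp_all add: p5 cyc_5)
  have d: "distinct [x,y,z,t,w]" and E: "edges K \<subseteq> edges G"
    and di: "distinct (map c [{x,y},{y,z},{z,t},{t,w},{w,x}])"
    using p(1) unfolding p5 rainbow_cycle_5 K by (auto simp only: list.map)
  have V: "verts K \<subseteq> verts G"
    using E assms unfolding simple_graph_def K by (auto simp: insert_subset)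
  have "graph_iso (cycle_graph 5) K"
    unfolding graph_iso_def
  proof (intro exI conjI)
    show "bij_betw ((!) p) (verts (cycle_graph 5)) (verts K)"
      unfolding bij_betw_def verts_cycle_graph_5 K using d by (auto simp: p5)
    show "edges K = (\<lambda>e. (!) p ` e) ` edges (cycle_graph 5)"
      unfolding edges_cycle_graph_5 K by (simp add: p5)
  qed
  moreover have "subgraph K G"
    using E V d unfolding subgraph_def simple_graph_def K by auto
  moreover have "rainbow c K"
    using di unfolding distinct_map rainbow_def K by (simp only: list.set)
  ultimately show "K \<in> rainbow_copies (cycle_graph 5) G c" unfolding rainbow_copies_def by blast
qed

lemma cyc_rotate:
  assumes "rainbow_cycle G c p" "v \<in> set p"
  obtains q where "rainbow_cycle G c q" "cyc q = cyc p" "hd q = v"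
proof -
  obtain x y z t w where p: "p = [x,y,z,t,w]" using rainbow_cycleE[OF assms(1)] .
  have R: "rainbow_cycle G c [y,z,t,w,x]" "cyc [y,z,t,w,x] = cyc [x,y,z,t,w]"
    if "rainbow_cycle G c [x,y,z,t,w]" for x y z t w
    using that unfolding rainbow_cycle_5 cyc_5 by auto
  note 1 = R[OF assms(1)[unfolded p]]
  note 2 = R[OF 1(1)]
  note 3 = R[OF 2(1)]
  note 4 = R[OF 3(1)]
  consider "v = x" | "v = y" | "v = z" | "v = t" | "v = w" using assms(2) p by auto
  then show ?thesis
    by cases (use assms(1) p that 1 2 3 4 in \<open>metis list.sel(1)\<close>)+
qed

section \<open>Counting the cycles through a fixed vertex\<close>

definition cycles_at :: "'a ugraph \<Rightarrow> ('a set \<Rightarrow> 'c) \<Rightarrow> 'a \<Rightarrow> 'a ugraph set" where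
  "cycles_at G c v = {K \<in> rainbow_copies (cycle_graph 5) G c. v \<in> verts K}"

lemma cycles_at_iff:
  assumes "simple_graph G"
  shows "K \<in> cycles_at G c v \<longleftrightarrow> (\<exists>p. rainbow_cycle G c p \<and> hd p = v \<and> K = cyc p)"
proof
  assume "K \<in> cycles_at G c v"
  then obtain p where "rainbow_cycle G c p" "K = cyc p" "v \<in> set p"
    unfolding cycles_at_def rainbow_copies_C5[OF assms] by (auto simp: cyc_def)
  then show "\<exists>p. rainbow_cycle G c p \<and> hd p = v \<and> K = cyc p" by (metis cyc_rotate)
next
  assume "\<exists>p. rainbow_cycle G c p \<and> hd p = v \<and> K = cyc p"
  then obtain p where p: "rainbow_cycle G c p" "hd p = v" "K = cyc p" by blast
  then have "p \<noteq> []" by (auto simp: rainbow_cycle_def)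
  then show "K \<in> cycles_at G c v"
    using p unfolding cycles_at_def rainbow_copies_C5[OF assms] by (auto simp: cyc_def)
qed

lemma verts_cyc: "verts (cyc p) = set p"
  by (simp add: cyc_def)

lemma colors_cyc: "rainbow_cycle G c p \<Longrightarrow> c ` edges (cyc p) = set (cycle_cols c p)"
  by (erule rainbow_cycleE) (simp add: cyc_5 cycle_cols_5)

lemma card_rainbow_cycle:
  assumes "rainbow_cycle G c p"
  shows "card (set p) = 5" "card (set (cycle_cols c p)) = 5"
proof -
  obtain x y z t w where "p = [x,y,z,t,w]" using rainbow_cycleE[OF assms] .
  then have "distinct p" "length p = 5" "distinct (cycle_cols c p)" "length (cycle_cols c p) = 5"
    using assms by (simp_all add: rainbow_cycle_5 cycle_cols_5)
  then show "card (set p) = 5" "card (set (cycle_cols c p)) = 5" by (metis distinct_card)+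
qed

text \<open>One chosen list per subgraph, together with the reflections, gives two injective images
  in \<open>L\<close>; they are disjoint since no list equals its reflection.\<close>

lemma two_card_le:
  assumes "finite L" "\<And>q. q \<in> L \<Longrightarrow> rainbow_cycle G c q \<Longrightarrow> reflect q \<in> L"
    and "\<And>K. K \<in> \<K> \<Longrightarrow> \<exists>q\<in>L. rainbow_cycle G c q \<and> cyc q = K"
  shows "2 * card \<K> \<le> card L"
proof -
  obtain f where f: "\<And>K. K \<in> \<K> \<Longrightarrow> f K \<in> L \<and> rainbow_cycle G c (f K) \<and> cyc (f K) = K"
    using assms(3) by metis
  let ?g = "\<lambda>K. reflect (f K)"
  have g: "cyc (?g K) = K" "?g K \<in> L" if "K \<in> \<K>" for K
    using f[OF that] reflect(2)[of G c "f K"] assms(2) by auto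
  have "inj_on f \<K>" by (rule inj_on_inverseI[of _ cyc]) (use f in blast)
  moreover have "inj_on ?g \<K>" by (rule inj_on_inverseI[of _ cyc]) (use g in blast)
  moreover have "f ` \<K> \<inter> ?g ` \<K> = {}"
  proof (rule ccontr)
    assume "f ` \<K> \<inter> ?g ` \<K> \<noteq> {}"
    then obtain K K' where K: "K \<in> \<K>" "K' \<in> \<K>" "f K = ?g K'" by auto
    then have "K = K'" using f g by metis
    then show False using K f[OF K(2)] reflect(4)[of G c "f K'"] by metis
  qed
  moreover have sub: "f ` \<K> \<union> ?g ` \<K> \<subseteq> L" using f g by auto
  ultimately have "card (f ` \<K> \<union> ?g ` \<K>) = 2 * card \<K>"
    using finite_subset[OF sub assms(1)] by (subst card_Un_disjoint) (auto simp: card_image)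
  then show ?thesis using card_mono[OF assms(1) sub] by simp
qed

lemma finite_distinct_lists:
  assumes "finite A"
  shows "finite {xs. length xs = k \<and> distinct xs \<and> set xs \<subseteq> A}"
  by (rule finite_subset[OF _ finite_lists_length_eq[OF assms, of k]]) auto

text \<open>After \<open>v\<close> the other four vertices come in one of 4! orders, and each cycle
  uses two of them.\<close>

lemma card_cycles_same_verts:
  assumes G: "simple_graph G" and K0: "K0 \<in> cycles_at G c v"
  shows "card {K \<in> cycles_at G c v. verts K = verts K0} \<le> 12"
proof -
  define W where "W = verts K0"
  obtain q0 where q0: "rainbow_cycle G c q0" "hd q0 = v" "W = set q0"
    using K0 unfolding cycles_at_iff[OF G] W_def by (auto simp: verts_cyc)
  then have W: "card W = 5" "v \<in> W"
    using card_rainbow_cycle(1)[OF q0(1)] by (auto intro!: hd_in_set)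
  have fin: "finite W" using W by (metis card.infinite zero_neq_numeral)
  let ?A = "{xs. length xs = 4 \<and> distinct xs \<and> set xs \<subseteq> W - {v}}"
  have "card ?A = \<Prod>{card (W - {v}) - 4 + 1..card (W - {v})}"
    using fin W by (intro card_lists_distinct_length_eq) auto
  also have "\<dots> = 24" using fin W by (simp add: card_Diff_singleton atLeastAtMost_upt upt_rec numeral_eq_Suc)
  finally have A: "card ?A = 24" .
  have finA: "finite ?A" using finite_distinct_lists[of "W - {v}"] fin by simp
  have "2 * card {K \<in> cycles_at G c v. verts K = W} \<le> card ((#) v ` ?A)"
  proof (rule two_card_le)
    fix q assume q: "q \<in> (#) v ` ?A" "rainbow_cycle G c q"
    then show "reflect q \<in> (#) v ` ?A" by (auto simp: reflect_def)
  next
    fix K assume "K \<in> {K \<in> cycles_at G c v. verts K = W}"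
    then obtain q where q: "rainbow_cycle G c q" "hd q = v" "K = cyc q" "set q = W"
      unfolding cycles_at_iff[OF G] by (auto simp: verts_cyc)
    obtain x y z t w where q5: "q = [x,y,z,t,w]" using rainbow_cycleE[OF q(1)] .
    have "q \<in> (#) v ` ?A" using q unfolding q5 rainbow_cycle_5 by auto
    then show "\<exists>q\<in>(#) v ` ?A. rainbow_cycle G c q \<and> cyc q = K" using q by blast
  qed (use finA in simp)
  also have "\<dots> \<le> 24" using card_image_le[OF finA, of "(#) v"] A by simp
  finally show ?thesis by (simp add: W_def)
qed

context rainbow_P5_free
begin

text \<open>By properness the colour word read from \<open>v\<close> determines the list; there are
  5! words and two directions.\<close>

lemma card_cycles_same_colors:
  assumes K0: "K0 \<in> cycles_at G c v"
  shows "card {K \<in> cycles_at G c v. c ` edges K = c ` edges K0} \<le> 60"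
proof -
  define S where "S = c ` edges K0"
  have S: "card S = 5"
    using K0 card_rainbow_cycle(2) unfolding cycles_at_iff[OF simple] S_def by (metis colors_cyc)
  then have fin: "finite S" by (metis card.infinite zero_neq_numeral)
  let ?A = "{xs. length xs = 5 \<and> distinct xs \<and> set xs \<subseteq> S}"
  have "card ?A = \<Prod>{card S - 5 + 1..card S}"
    using fin S by (intro card_lists_distinct_length_eq) auto
  also have "\<dots> = 120" by (simp add: S atLeastAtMost_upt upt_rec numeral_eq_Suc)
  finally have A: "card ?A = 120" .
  have finA: "finite ?A" using finite_distinct_lists[OF fin] .
  let ?L = "{q. rainbow_cycle G c q \<and> hd q = v \<and> set (cycle_cols c q) = S}"
  have inj: "inj_on (cycle_cols c) ?L"
  proof (rule inj_onI)
    fix q r assume qr: "q \<in> ?L" "r \<in> ?L" "cycle_cols c q = cycle_cols c r"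
    obtain x y z t w where q: "q = [x,y,z,t,w]" using rainbow_cycleE qr(1) by blast
    obtain x' y' z' t' w' where r: "r = [x',y',z',t',w']" using rainbow_cycleE qr(2) by blast
    have x: "x' = x" using qr q r by simp
    have E: "{x,y} \<in> edges G" "{y,z} \<in> edges G" "{z,t} \<in> edges G" "{t,w} \<in> edges G"
      "{x,y'} \<in> edges G" "{y',z'} \<in> edges G" "{z',t'} \<in> edges G" "{t',w'} \<in> edges G"
      using qr(1,2) unfolding q r x by (auto simp: rainbow_cycle_5)
    have C: "c {x,y} = c {x,y'}" "c {y,z} = c {y',z'}" "c {z,t} = c {z',t'}" "c {t,w} = c {t',w'}"
      using qr(3) unfolding q r x cycle_cols_5 by auto
    have 1: "y = y'" using proper_unique E C by blast
    have 2: "z = z'" using proper_unique[of y z z'] E C 1 by simp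
    have 3: "t = t'" using proper_unique[of z t t'] E C 2 by simp
    have 4: "w = w'" using proper_unique[of t w w'] E C 3 by simp
    show "q = r" using 1 2 3 4 x q r by simp
  qed
  have im: "cycle_cols c ` ?L \<subseteq> ?A"
  proof
    fix xs assume "xs \<in> cycle_cols c ` ?L"
    then obtain q where q: "rainbow_cycle G c q" "set (cycle_cols c q) = S" "xs = cycle_cols c q" by blast
    obtain x y z t w where q5: "q = [x,y,z,t,w]" using rainbow_cycleE[OF q(1)] .
    show "xs \<in> ?A" using q unfolding q5 rainbow_cycle_5 cycle_cols_5 by auto
  qed
  have "2 * card {K \<in> cycles_at G c v. c ` edges K = S} \<le> card ?L"
  proof (rule two_card_le)
    show "finite ?L" by (rule finite_imageD[OF finite_subset[OF im finA] inj])
    fix q assume "q \<in> ?L" "rainbow_cycle G c q"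
    then show "reflect q \<in> ?L" using reflect[of G c q] by simp
  next
    fix K assume "K \<in> {K \<in> cycles_at G c v. c ` edges K = S}"
    then show "\<exists>q\<in>?L. rainbow_cycle G c q \<and> cyc q = K"
      unfolding cycles_at_iff[OF simple] using colors_cyc by blast
  qed
  also have "\<dots> \<le> 120" using card_mono[OF finA im] card_image[OF inj] A by simp
  finally show ?thesis by (simp add: S_def)
qed

text \<open>Sending a cycle to the class of its code is injective: equal codes give equal cycles,
  and different codes of one class conflict. There are 17 classes.\<close>

lemma card_cycles_far:
  assumes p: "rainbow_cycle G c p"
  shows "card {K \<in> cycles_at G c (hd p). verts K \<noteq> verts (cyc p) \<and> c ` edges K \<noteq> c ` edges (cyc p)} \<le> 17"
    (is "card ?X \<le> 17")
proof -
  define P where "P K q k i \<longleftrightarrow> rainbow_cycle G c q \<and> hd q = hd p \<and> cyc q = K \<and> i < 17 \<and>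
    k \<in> set (code_classes ! i) \<and> described c p q k" for K q k i
  define X where "X = ?X"
  have "\<exists>q k i. P K q k i" if "K \<in> X" for K
  proof -
    have K: "K \<in> ?X" using that by (simp add: X_def)
    obtain q where q: "rainbow_cycle G c q" "hd q = hd p" "K = cyc q"
      using K unfolding cycles_at_iff[OF simple] by auto
    \<comment> \<open>Both sets have five elements, so inclusion would be equality.\<close>
    have "\<not> set q \<subseteq> set p"
      using K q p card_subset_eq[of "set p" "set q"] card_rainbow_cycle(1)[of G c]
      by (auto simp: verts_cyc)
    moreover have "\<not> set (cycle_cols c q) \<subseteq> set (cycle_cols c p)"
      using K q p card_subset_eq[of "set (cycle_cols c p)" "set (cycle_cols c q)"]
        card_rainbow_cycle(2)[of G c] by (auto simp: colors_cyc)
    ultimately obtain q' k where "rainbow_cycle G c q'" "hd q' = hd p" "cyc q' = cyc q" "k \<in> set codes"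
      "described c p q' k" using cycle_described[OF p q(1,2)] by blast
    moreover from \<open>k \<in> set codes\<close> obtain cl where "cl \<in> set code_classes" "k \<in> set cl"
      by (auto simp: codes_def)
    moreover from \<open>cl \<in> set code_classes\<close> obtain i where "i < 17" "cl = code_classes ! i"
      using length_code_classes by (auto simp: in_set_conv_nth)
    ultimately show ?thesis using q(3) unfolding P_def by blast
  qed
  then obtain Q k i where "\<And>K. K \<in> X \<Longrightarrow> P K (Q K) (k K) (i K)"
    by metis
  note Q = this[unfolded P_def X_def]
  have "inj_on i ?X"
  proof (rule inj_onI)
    fix K K' assume K: "K \<in> ?X" "K' \<in> ?X" "i K = i K'"
    note QK = Q[OF K(1)] Q[OF K(2)]
    have cl: "code_classes ! i K \<in> set code_classes" using QK length_code_classes by simp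
    show "K = K'"
    proof (cases "k K = k K'")
      case True
      have "determined_code (k K)" using list_all_determined cl QK by (auto simp: list_all_iff codes_def)
      then have "Q K = Q K'" using QK True by (intro determined[of _ p "k K"]) auto
      then show ?thesis using QK by metis
    next
      case False
      have "sorted_wrt conflict (code_classes ! i K)" using code_classes_conflict cl by (simp add: list_all_iff)
      \<comment> \<open>\<open>sorted_wrt\<close> gives the conflict only in the order of the
        list.\<close>
      then have "conflict (k K) (k K') \<or> conflict (k K') (k K)"
        using QK K(3) False unfolding sorted_wrt_iff_nth_less in_set_conv_nth
        by (metis linorder_neqE_nat)
      then show ?thesis using conflict_False[OF p] QK by blast
    qed
  qed
  moreover have "i ` ?X \<subseteq> {..<17}" using Q by blast
  ultimately show ?thesis using card_inj_on_le[of i ?X "{..<17}"] by simp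
qed

lemma card_cycles_at_le: "card (cycles_at G c v) \<le> 60"
proof -
  let ?V = "verts" and ?S = "\<lambda>K. c ` edges K" and ?A = "cycles_at G c v"
  have fin: "finite ?A" using finite_rainbow_copies[OF simple] unfolding cycles_at_def by (rule finite_subset[rotated]) blast
  \<comment> \<open>If \<open>C\<close> and \<open>D\<close> differ in colours but not in vertices,
    a cycle with another vertex set cannot share its colours with both, so it differs from one of
    them in both respects.\<close>
  consider "\<exists>C\<in>?A. \<forall>K\<in>?A. ?S K = ?S C" | "\<exists>C\<in>?A. \<forall>K\<in>?A. ?V K = ?V C"
    | "\<exists>C\<in>?A. \<exists>D\<in>?A. ?V D \<noteq> ?V C \<and> ?S D \<noteq> ?S C" | "?A = {}" 
    by (metis ex_in_conv)
  then show ?thesis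
  proof cases
    case 1
    then obtain C where C: "C \<in> ?A" "\<forall>K\<in>?A. ?S K = ?S C" by blast
    then have "?A = {K \<in> ?A. ?S K = ?S C}" by blast
    then show ?thesis using card_cycles_same_colors[OF C(1)] by simp
  next
    case 2
    then obtain C where C: "C \<in> ?A" "\<forall>K\<in>?A. ?V K = ?V C" by blast
    then have "?A = {K \<in> ?A. ?V K = ?V C}" by blast
    then show ?thesis using card_cycles_same_verts[OF simple C(1)] by simp
  next
    case 3
    then obtain C D where CD: "C \<in> ?A" "D \<in> ?A" "?V D \<noteq> ?V C" "?S D \<noteq> ?S C" by blast
    let ?R = "\<lambda>C. {K \<in> ?A. ?V K = ?V C}" and ?X = "\<lambda>C. {K \<in> ?A. ?V K \<noteq> ?V C \<and> ?S K \<noteq> ?S C}"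
    have X: "card (?X C) \<le> 17" if C: "C \<in> ?A" for C
    proof -
      obtain p where "rainbow_cycle G c p" "hd p = v" "C = cyc p"
        using C unfolding cycles_at_iff[OF simple] by blast
      then show ?thesis using card_cycles_far by blast
    qed
    \<comment> \<open>The colour sets of \<open>C\<close> and \<open>D\<close> differ, so no cycle
      has both.\<close>
    have "?A \<subseteq> (?R C \<union> ?R D) \<union> (?X C \<union> ?X D)" using CD(3,4) by auto
    then have "card ?A \<le> card ((?R C \<union> ?R D) \<union> (?X C \<union> ?X D))"
      using fin by (intro card_mono) auto
    also have "\<dots> \<le> (card (?R C) + card (?R D)) + (card (?X C) + card (?X D))"
      by (meson add_mono card_Un_le order_trans)
    also have "\<dots> \<le> 60"
      using card_cycles_same_verts[OF simple CD(1)] card_cycles_same_verts[OF simple CD(2)]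
        X[OF CD(1)] X[OF CD(2)] by linarith
    finally show ?thesis .
  qed simp
qed

end

text \<open>Double counting of pairs of a vertex and a copy containing it.\<close>

lemma five_card_copies:
  assumes "simple_graph G"
  shows "5 * card (rainbow_copies (cycle_graph 5) G c) = (\<Sum>v\<in>verts G. card (cycles_at G c v))"
proof -
  let ?K = "rainbow_copies (cycle_graph 5) G c"
  have "(\<Sum>v\<in>verts G. card {K \<in> ?K. v \<in> verts K}) = 5 * card ?K"
  proof (rule sum_multicount)
    show "finite (verts G)" using assms by (simp add: simple_graph_def)
    show "finite ?K" by (rule finite_rainbow_copies[OF assms])
    show "\<forall>K\<in>?K. card {v \<in> verts G. v \<in> verts K} = 5"
    proof
      fix K assume K: "K \<in> ?K"
      then have "{v \<in> verts G. v \<in> verts K} = verts K"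
        by (auto simp: rainbow_copies_def subgraph_def)
      moreover have "card (verts K) = 5"
        using K card_rainbow_cycle(1)[of G c] unfolding rainbow_copies_C5[OF assms] by (auto simp: verts_cyc)
      ultimately show "card {v \<in> verts G. v \<in> verts K} = 5" by simp
    qed
  qed
  then show ?thesis by (simp add: cycles_at_def)
qed

lemma (in rainbow_P5_free) card_copies_le: "card (rainbow_copies (cycle_graph 5) G c) \<le> 12 * card (verts G)"
proof -
  have "5 * card (rainbow_copies (cycle_graph 5) G c) \<le> (\<Sum>v\<in>verts G. 60)"
    unfolding five_card_copies[OF simple] by (intro sum_mono card_cycles_at_le)
  then show ?thesis by simp
qed

section \<open>The lower bound\<close>

text \<open>The converse of \<open>rainbow_path_copy\<close>, used to show that the construction is
  free of rainbow copies.\<close>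

lemma rainbow_copies_P5:
  assumes "K \<in> rainbow_copies (path_graph 5) G c"
  shows "\<exists>p. rainbow_path G c p \<and> length p = 6"
proof -
  obtain f where f: "bij_betw f {0,1,2,3,4,5::nat} (verts K)"
    and e: "edges K = (\<lambda>e. f ` e) ` {{0,1},{1,2},{2,3},{3,4},{4,5}}"
    using assms unfolding rainbow_copies_def graph_iso_def verts_path_graph_5 edges_path_graph_5 by blast
  let ?p = "[f 0, f 1, f 2, f 3, f 4, f 5]"
  have d: "distinct ?p" using f by (simp add: bij_betw_def inj_on_def)
  have E: "edges K = {{f 0,f 1},{f 1,f 2},{f 2,f 3},{f 3,f 4},{f 4,f 5}}"
    unfolding e by simp
  have "inj_on c (edges K)" "edges K \<subseteq> edges G"
    using assms by (auto simp: rainbow_copies_def rainbow_def subgraph_def)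
  moreover have "distinct [{f 0,f 1},{f 1,f 2},{f 2,f 3},{f 3,f 4},{f 4,f 5}]"
    using d by (simp add: doubleton_eq_iff)
  ultimately have "distinct (map c [{f 0,f 1},{f 1,f 2},{f 2,f 3},{f 3,f 4},{f 4,f 5}])"
    unfolding E distinct_map by simp
  then have "rainbow_path G c ?p"
    using d \<open>edges K \<subseteq> edges G\<close> unfolding rainbow_path_def E by simp
  then show ?thesis by (intro exI[of _ ?p]) simp
qed

text \<open>Every vertex of the cycle has two neighbours, so the second vertex forces the rest: each
  step goes to the neighbour not just left.\<close>

lemma cyc_eq_cases:
  assumes "rainbow_cycle G c p" "rainbow_cycle G c q" "hd q = hd p" "cyc q = cyc p"
  shows "q = p \<or> q = reflect p"
proof -
  obtain x y z t w where p: "p = [x,y,z,t,w]" using rainbow_cycleE[OF assms(1)] .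
  obtain y' z' t' w' where q: "q = [x,y',z',t',w']"
    using rainbow_cycleE[OF assms(2)] assms(3) p by (metis list.sel(1))
  have d: "distinct [x,y,z,t,w]" "distinct [x,y',z',t',w']"
    using assms(1,2) unfolding p q rainbow_cycle_5 by auto
  have nb: "v = b \<or> v = h" if "{a, v} \<in> {{a,b},{b,f},{f,g},{g,h},{h,a}}" "distinct [a,b,f,g,h]"
    for a b f g h v :: 'a
    using that by (auto simp: doubleton_eq_iff)
  have "edges (cyc q) = edges (cyc p)" using assms(4) by simp
  then have e: "{{x,y'},{y',z'},{z',t'},{t',w'},{w',x}} = {{x,y},{y,z},{z,t},{t,w},{w,x}}"
    by (simp only: p q cyc_5 snd_conv)
  have E: "{x,y'} \<in> {{x,y},{y,z},{z,t},{t,w},{w,x}}" "{y',z'} \<in> {{x,y},{y,z},{z,t},{t,w},{w,x}}"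
    "{z',t'} \<in> {{x,y},{y,z},{z,t},{t,w},{w,x}}" "{t',w'} \<in> {{x,y},{y,z},{z,t},{t,w},{w,x}}"
    unfolding e[symmetric] by simp_all
  have ny: "v = z \<or> v = x" if "{y, v} \<in> {{x,y},{y,z},{z,t},{t,w},{w,x}}" for v
    using nb[of y v z t w x] that d(1) by auto
  have nz: "v = t \<or> v = y" if "{z, v} \<in> {{x,y},{y,z},{z,t},{t,w},{w,x}}" for v
    using nb[of z v t w x y] that d(1) by auto
  have nt: "v = w \<or> v = z" if "{t, v} \<in> {{x,y},{y,z},{z,t},{t,w},{w,x}}" for v
    using nb[of t v w x y z] that d(1) by auto
  have nw: "v = x \<or> v = t" if "{w, v} \<in> {{x,y},{y,z},{z,t},{t,w},{w,x}}" for v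
    using nb[of w v x y z t] that d(1) by auto
  consider "y' = y" | "y' = w" using nb[OF E(1) d(1)] by blast
  then show ?thesis
  proof cases
    case 1
    have z: "z' = z" using ny[OF E(2)[unfolded 1]] d(2) by auto
    have t: "t' = t" using nz[OF E(3)[unfolded z]] d(2) 1 by auto
    have "w' = w" using nt[OF E(4)[unfolded t]] d(2) z by auto
    then show ?thesis using p q 1 z t by simp
  next
    case 2
    have z: "z' = t" using nw[OF E(2)[unfolded 2]] d(2) by auto
    have t: "t' = z" using nt[OF E(3)[unfolded z]] d(2) 2 by auto
    have "w' = y" using nz[OF E(4)[unfolded t]] d(2) z by auto
    then show ?thesis using p q 2 z t by (simp add: reflect_def)
  qed
qed

text \<open>A choice of one list per cycle and its reflection cover all lists from \<open>v\<close>,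
  the opposite bound to \<open>two_card_le\<close>.\<close>

lemma card_rainbow_cycle_lists_le:
  assumes "simple_graph G"
  shows "card {q. rainbow_cycle G c q \<and> hd q = v} \<le> 2 * card (cycles_at G c v)"
proof -
  let ?A = "cycles_at G c v" and ?L = "{q. rainbow_cycle G c q \<and> hd q = v}"
  have fin: "finite ?A"
    using finite_rainbow_copies[OF assms] unfolding cycles_at_def by (rule finite_subset[rotated]) blast
  define f where "f K = (SOME q. rainbow_cycle G c q \<and> hd q = v \<and> K = cyc q)" for K
  have f: "rainbow_cycle G c (f K) \<and> hd (f K) = v \<and> K = cyc (f K)" if "K \<in> ?A" for K
    using that unfolding cycles_at_iff[OF assms] f_def by (rule someI_ex)
  have "?L \<subseteq> f ` ?A \<union> (reflect \<circ> f) ` ?A"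
  proof
    fix q assume q: "q \<in> ?L"
    then have K: "cyc q \<in> ?A" unfolding cycles_at_iff[OF assms] by blast
    have "q = f (cyc q) \<or> q = reflect (f (cyc q))"
      using q f[OF K] by (intro cyc_eq_cases[of G c]) auto
    then show "q \<in> f ` ?A \<union> (reflect \<circ> f) ` ?A" using K by auto
  qed
  then have "card ?L \<le> card (f ` ?A \<union> (reflect \<circ> f) ` ?A)"
    using fin by (intro card_mono) auto
  also have "\<dots> \<le> card (f ` ?A) + card ((reflect \<circ> f) ` ?A)" by (rule card_Un_le)
  also have "\<dots> \<le> card ?A + card ?A" by (intro add_mono card_image_le fin)
  finally show ?thesis by simp
qed

section \<open>Disjoint copies of a Cayley graph of order 16\<close>

definition gens :: "nat set" where
  "gens = {1, 2, 4, 8, 15}"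

text \<open>Addition in the group is \<open>xor\<close>. Generators below 16 change only the last
  four binary digits, so for \<open>16 dvd n\<close> each block of 16 consecutive numbers is one
  copy.\<close>

definition cube_graph :: "nat \<Rightarrow> nat ugraph" where
  "cube_graph n = ({..<n}, {{u, xor u g} | u g. u < n \<and> g \<in> gens})"

text \<open>\<open>Min\<close> and \<open>Max\<close> recover the ends of an edge from the set;
  their \<open>xor\<close> is its generator.\<close>

definition cube_color :: "nat set \<Rightarrow> nat" where
  "cube_color e = xor (Min e) (Max e)"

lemma cube_color: "cube_color {u, v} = xor u v"
  by (simp add: cube_color_def min_def max_def xor.commute)

lemma xor_cancel_left [simp]: "xor u (xor u v) = (v::nat)"
  by (simp flip: xor.assoc)

lemma xor_cancel_conj [simp]: "xor (xor u v) u = (v::nat)"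
  by (metis xor.commute xor_cancel_left)

lemma gens_less: "g \<in> gens \<Longrightarrow> g < 16" "g \<in> gens \<Longrightarrow> g \<noteq> 0"
  by (auto simp: gens_def)

lemma xor_cancel_both: "xor (xor u x) (xor u y) = xor x (y::nat)"
  by (metis xor.assoc xor.commute xor_cancel_left)

lemma xor_eq_iff:
  fixes u v w :: nat
  shows "xor u v = xor u w \<longleftrightarrow> v = w" "xor u v = u \<longleftrightarrow> v = 0" "u = xor u v \<longleftrightarrow> v = 0"
  by (metis xor_cancel_left, (metis xor_cancel_left xor_self_eq xor.right_neutral)+)

lemma xor_eq_0_iff: "xor u v = 0 \<longleftrightarrow> u = (v::nat)"
  by (metis xor_cancel_left xor_self_eq xor.right_neutral)

lemma xor_gens:
  assumes "distinct [a, b, d, e, f]" "{a, b, d, e, f} \<subseteq> gens"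
  shows "xor a (xor b (xor d (xor e f))) = 0"
proof -
  \<comment> \<open>Folding over the set makes the sum independent of the order of the
    generators.\<close>
  interpret comp_fun_commute "xor :: nat \<Rightarrow> nat \<Rightarrow> nat"
    by standard (simp add: fun_eq_iff xor.left_commute)
  have "card {a, b, d, e, f} = card gens" using assms(1) by (simp add: gens_def)
  then have "{a, b, d, e, f} = {1, 2, 4, 8, 15}"
    using assms(2) card_subset_eq[of gens] by (simp add: gens_def)
  then have "Finite_Set.fold xor 0 {a, b, d, e, f} = Finite_Set.fold xor 0 {1, 2, 4, 8, 15}"
    by simp
  also have "\<dots> = xor 1 (xor 2 (xor 4 (xor 8 15)))" by simp
  also have "\<dots> = 0" by (simp add: xor_nat_unfold)
  finally show ?thesis using assms(1) by simp
qed

text \<open>The total sum is 0, so a sum of three or four generators equals that of the remaining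
  ones and is nonzero; hence the partial sums are distinct.\<close>

lemma gens_word:
  assumes "distinct [a, b, d, e, f]" "{a, b, d, e, f} \<subseteq> gens"
  shows "xor a (xor b (xor d e)) = f"
    and "distinct [v, xor v a, xor v (xor a b), xor v (xor a (xor b d)), xor v (xor a (xor b (xor d e)))]"
proof -
  have "xor (xor a (xor b d)) (xor e f) = 0" "xor (xor b (xor d e)) (xor f a) = 0"
    and *: "xor (xor a (xor b (xor d e))) f = 0"
    using xor_gens[OF assms] by (simp_all add: ac_simps)
  then have "xor a (xor b d) \<noteq> 0" "xor b (xor d e) \<noteq> 0" "xor a b \<noteq> 0" "xor b d \<noteq> 0" "xor d e \<noteq> 0"
    "xor a (xor b (xor d e)) \<noteq> 0"
    using assms gens_less(2) by (auto simp: xor_eq_0_iff)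
  then show "distinct [v, xor v a, xor v (xor a b), xor v (xor a (xor b d)), xor v (xor a (xor b (xor d e)))]"
    using assms(2) gens_less(2) by (simp add: xor_eq_iff)
  show "xor a (xor b (xor d e)) = f" using * by (simp only: xor_eq_0_iff)
qed

lemma xor_less:
  fixes u g n :: nat
  assumes "16 dvd n" "u < n" "g < 16"
  shows "xor u g < n"
proof -
  have "drop_bit 4 (xor u g) = drop_bit 4 u"
    using assms(3) by (simp add: drop_bit_xor drop_bit_eq_div[of 4 g])
  then have "xor u g div 16 = u div 16" by (simp add: drop_bit_eq_div)
  also have "\<dots> < n div 16" using assms(1,2) by (metis div_less_mono zero_less_numeral dvd_imp_mod_0 mod_0_imp_dvd dvd_div_mult_self less_mult_imp_div_less)
  finally show ?thesis using assms(1) by (metis dvd_div_mult_self div_less_iff_less_mult zero_less_numeral)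
qed

lemma cube_edge_iff:
  assumes "16 dvd n"
  shows "{u, v} \<in> edges (cube_graph n) \<longleftrightarrow> u < n \<and> xor u v \<in> gens"
proof
  assume "{u, v} \<in> edges (cube_graph n)"
  then obtain w g where w: "{u, v} = {w, xor w g}" "w < n" "g \<in> gens" by (auto simp: cube_graph_def)
  then consider "u = w" "v = xor w g" | "u = xor w g" "v = w" by (auto simp: doubleton_eq_iff)
  then show "u < n \<and> xor u v \<in> gens"
    by cases (use w xor_less[OF assms] gens_less in auto)
next
  assume *: "u < n \<and> xor u v \<in> gens"
  have "{u, v} = {u, xor u (xor u v)}" by simp
  then show "{u, v} \<in> edges (cube_graph n)"
    using * unfolding cube_graph_def snd_conv by blast
qed

lemma simple_cube_graph:
  assumes "16 dvd n"
  shows "simple_graph (cube_graph n)"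
proof -
  have "u \<noteq> xor u g" if "g \<in> gens" for u g
    using gens_less(2)[OF that] by (metis xor_cancel_left xor_self_eq)
  then show ?thesis
    using xor_less[OF assms] gens_less(1) unfolding simple_graph_def cube_graph_def by auto
qed

lemma proper_cube_color: 
  assumes "16 dvd n"
  shows "proper_edge_coloring (cube_graph n) cube_color"
  unfolding proper_edge_coloring_def
proof (intro ballI impI notI)
  fix e f assume ef: "e \<in> edges (cube_graph n)" "f \<in> edges (cube_graph n)" "e \<noteq> f \<and> e \<inter> f \<noteq> {}"
    "cube_color e = cube_color f"
  then obtain u where u: "u \<in> e" "u \<in> f" by blast
  have *: "\<exists>v. e = {u, v}" if "e \<in> edges (cube_graph n)" "u \<in> e" for e
    using that by (auto simp: cube_graph_def)
  obtain v w where vw: "e = {u, v}" "f = {u, w}" using *[OF ef(1) u(1)] *[OF ef(2) u(2)] by blast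
  then have "xor u v = xor u w" using ef(4) by (simp add: cube_color)
  then have "v = w" by (metis xor_cancel_left)
  then show False using vw ef(3) by simp
qed

text \<open>The five colours of a rainbow path with five edges sum to 0, so it would end at its
  start.\<close>

lemma cube_P5_free:
  assumes "16 dvd n"
  shows "rainbow_copies (path_graph 5) (cube_graph n) cube_color = {}"
proof (rule ccontr)
  assume "rainbow_copies (path_graph 5) (cube_graph n) cube_color \<noteq> {}"
  then obtain p where p: "rainbow_path (cube_graph n) cube_color p" "length p = 6"
    using rainbow_copies_P5 by blast
  then obtain x0 x1 x2 x3 x4 x5 where p6: "p = [x0,x1,x2,x3,x4,x5]" using length_eq_6 by metis
  have w: "distinct [xor x0 x1, xor x1 x2, xor x2 x3, xor x3 x4, xor x4 x5]"
    "{xor x0 x1, xor x1 x2, xor x2 x3, xor x3 x4, xor x4 x5} \<subseteq> gens" "x0 \<noteq> x5"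
    using p(1) unfolding p6 rainbow_path_def by (simp_all add: cube_edge_iff[OF assms] cube_color)
  have "xor (xor x0 x1) (xor (xor x1 x2) (xor (xor x2 x3) (xor x3 x4))) = xor x4 x5"
    using gens_word(1)[OF w(1,2)] .
  then have "xor x0 x4 = xor x4 x5" by (simp add: xor.assoc)
  then show False using w(3) by (metis xor.commute xor_cancel_left)
qed

text \<open>All 5! words in the generators give different lists from \<open>v\<close>, two for each
  cycle.\<close>

lemma cube_cycles_at:
  assumes n: "16 dvd n" and v: "v < n"
  shows "60 \<le> card (cycles_at (cube_graph n) cube_color v)"
proof -
  let ?W = "{xs. length xs = 5 \<and> distinct xs \<and> set xs \<subseteq> gens}"
  let ?L = "{q. rainbow_cycle (cube_graph n) cube_color q \<and> hd q = v}"
  \<comment> \<open>Vertices are \<open>v\<close> plus the partial sums of the first four letters;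
    the fifth letter colours the closing edge.\<close>
  let ?\<phi> = "\<lambda>xs. [v, xor v (xs!0), xor v (xor (xs!0) (xs!1)), xor v (xor (xs!0) (xor (xs!1) (xs!2))),
    xor v (xor (xs!0) (xor (xs!1) (xor (xs!2) (xs!3))))]"
  have gens: "finite gens" "card gens = 5" by (simp_all add: gens_def)
  have "card ?W = \<Prod>{card gens - 5 + 1..card gens}"
    using gens by (intro card_lists_distinct_length_eq) auto
  also have "\<dots> = 120" by (simp add: gens atLeastAtMost_upt upt_rec numeral_eq_Suc)
  finally have W: "card ?W = 120" .
  have im: "?\<phi> ` ?W \<subseteq> ?L"
  proof
    fix q assume "q \<in> ?\<phi> ` ?W"
    then obtain xs where xs: "xs \<in> ?W" "q = ?\<phi> xs" by blast
    then have "length xs = 5" by simp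
    then obtain a b d e f where x5: "xs = [a,b,d,e,f]" unfolding length_eq_5 by blast
    have g: "distinct [a,b,d,e,f]" "{a,b,d,e,f} \<subseteq> gens" using xs x5 by auto
    note w = gens_word(1)[OF g]
    have q: "q = [v, xor v a, xor v (xor a b), xor v (xor a (xor b d)), xor v (xor a (xor b (xor d e)))]"
      using xs x5 by simp
    have "distinct q" unfolding q using gens_word(2)[OF g] .
    moreover have "xor (xor v (xor a (xor b (xor d e)))) v = f"
      using w by simp
    moreover have "xor a b < 16" "xor a (xor b d) < 16" "xor a (xor b (xor d e)) < 16" "a < 16"
      using g(2) gens_less(1) by (auto intro!: xor_less)
    then have "xor v a < n" "xor v (xor a b) < n" "xor v (xor a (xor b d)) < n"
      "xor v (xor a (xor b (xor d e))) < n"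
      using xor_less[OF n v] by blast+
    ultimately show "q \<in> ?L"
      using v g unfolding q
      by (simp only: mem_Collect_eq rainbow_cycle_5 cube_color list.sel insert_subset cube_edge_iff[OF n] xor_cancel_both
          xor_cancel_left simp_thms empty_subsetI)
  qed
  have inj: "inj_on ?\<phi> ?W"
  proof (rule inj_onI)
    fix xs ys assume xs: "xs \<in> ?W" "ys \<in> ?W" "?\<phi> xs = ?\<phi> ys"
    have "length xs = 5" "length ys = 5" using xs(1,2) by auto
    then obtain a b d e f a' b' d' e' f' where x5: "xs = [a,b,d,e,f]" and y5: "ys = [a',b',d',e',f']"
      unfolding length_eq_5 by blast
    have eq: "a = a'" "b = b'" "d = d'" "e = e'" using xs(3) unfolding x5 y5 by (auto simp: xor_eq_iff)
    have "xor a (xor b (xor d e)) = f" "xor a' (xor b' (xor d' e')) = f'"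
      using gens_word(1)[of a b d e f] gens_word(1)[of a' b' d' e' f'] xs(1,2) unfolding x5 y5 by auto
    then show "xs = ys" using eq x5 y5 by simp
  qed
  have fin: "finite ?L"
  proof (rule finite_subset)
    show "?L \<subseteq> {q. set q \<subseteq> {..<n} \<and> length q = 5}"
    proof
      fix q assume q: "q \<in> ?L"
      then obtain x y z t w where q5: "q = [x,y,z,t,w]" using rainbow_cycleE by blast
      show "q \<in> {q. set q \<subseteq> {..<n} \<and> length q = 5}"
        using q unfolding q5 by (simp add: rainbow_cycle_5 cube_edge_iff[OF n])
    qed
  qed (simp add: finite_lists_length_eq)
  have "card ?W \<le> card ?L" by (rule card_inj_on_le[OF inj im fin])
  then show ?thesis using card_rainbow_cycle_lists_le[OF simple_cube_graph[OF n], of cube_color v] W by simp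
qed

theorem theorem12:
  fixes n :: nat
  assumes "n > 0" and "16 dvd n"
  shows "ex_star n (cycle_graph 5) (path_graph 5) = 12 * n"
proof -
  let ?N = "rainbow_copy_counts n (cycle_graph 5) (path_graph 5)"
  have le: "m \<le> 12 * n" if m: "m \<in> ?N" for m
  proof -
    obtain G :: "nat ugraph" and c :: "nat set \<Rightarrow> nat" where
      "m = card (rainbow_copies (cycle_graph 5) G c)" "card (verts G) = n" "rainbow_P5_free G c"
      using m unfolding rainbow_copy_counts_def rainbow_P5_free_def by blast
    then show ?thesis using rainbow_P5_free.card_copies_le by blast
  qed
  let ?G = "cube_graph n"
  let ?m = "card (rainbow_copies (cycle_graph 5) ?G cube_color)"
  have vG: "verts ?G = {..<n}" by (simp add: cube_graph_def)
  have m: "?m \<in> ?N"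
    unfolding rainbow_copy_counts_def
    using simple_cube_graph[OF assms(2)] proper_cube_color[OF assms(2)] cube_P5_free[OF assms(2)] vG
    by (intro CollectI exI[of _ ?G] exI[of _ cube_color]) simp
  \<comment> \<open>At least 60 cycles at each of the \<open>n\<close> vertices, each cycle counted
    five times.\<close>
  have "(\<Sum>v\<in>verts ?G. 60) \<le> 5 * ?m"
    unfolding five_card_copies[OF simple_cube_graph[OF assms(2)]]
    by (intro sum_mono cube_cycles_at[OF assms(2)]) (simp add: vG)
  then have "12 * n \<le> ?m" by (simp add: vG)
  then have "12 * n \<in> ?N" using m le[OF m] by simp
  then show ?thesis
    unfolding ex_star_def by (intro Max_eqI finite_rainbow_copy_counts) (use le in auto)
qed

end
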